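(* Let $\alpha\in\{13,20,27,34,41,48\}$. For all integers $n\geqslant 0$, $$b_4(49n+\alpha) \equiv 0\pmod {64}.$$
   Context: $b_4(n)$ is the number of $4$-regular partitions of $n$, i.e. partitions of $n$ with no part divisible by $4$; equivalently $\sum_{n\geqslant 0} b_4(n)q^n=\prod_{m\geqslant 1}\frac{1-q^{4m}}{1-q^m}$. *)

theory Defs
  imports "HOL-Library.Multiset" "HOL-Number_Theory.Cong"
begin

text \<open>A partition of \<open>n\<close> is a multiset of positive integers with sum \<open>n\<close>.\<close>

definition partitions :: "nat \<Rightarrow> nat multiset set" where
  "partitions n = {M. 0 \<notin># M \<and> sum_mset M = n}"

definition regular_partitions :: "nat \<Rightarrow> nat \<Rightarrow> nat multiset set" where
  "regular_partitions l n = {M \<in> partitions n. \<forall>p\<in>#M. \<not> l dvd p}"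

definition b4 :: "nat \<Rightarrow> nat" where
  "b4 n = card (regular_partitions 4 n)"

text \<open>Since \<^const>\<open>card\<close> is 0 on infinite sets, finiteness is needed for \<^const>\<open>b4\<close> to be a genuine count.\<close>

lemma finite_partitions: "finite (partitions n)"
proof -
  have "partitions n \<subseteq> mset ` {xs. set xs \<subseteq> {..n} \<and> length xs \<le> n}"
  proof
    fix M assume "M \<in> partitions n"
    hence pos: "0 \<notin># M" and sum: "sum_mset M = n"
      by (simp_all add: partitions_def)
    have "size M \<le> sum_mset M"
      using pos by (induction M) auto
    moreover have "x \<le> n" if "x \<in># M" for x
      using that sum by (metis le_add1 multi_member_split sum_mset.add_mset)
    moreover obtain xs where "M = mset xs"
      using ex_mset by metis
    ultimately show "M \<in> mset ` {xs. set xs \<subseteq> {..n} \<and> length xs \<le> n}"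
      using sum by auto
  qed
  thus ?thesis
    by (rule finite_subset) (simp add: finite_lists_length_le)
qed

lemma finite_regular_partitions: "finite (regular_partitions l n)"
  by (rule finite_subset[OF _ finite_partitions]) (auto simp: regular_partitions_def)

end

theory Submission
  imports Defs "HOL-Computational_Algebra.Formal_Power_Series"
begin

text \<open>
  Write \<open>\<phi> = \<Sum>\<^sub>x X\<^sup>x\<^sup>2\<close> over all integers \<open>x\<close>,
  \<open>\<psi> = \<Sum>\<^sub>j X\<^bsup>2j\<^sup>2+j\<^esup>\<close> over all integers \<open>j\<close>, and let \<open>B\<close> be the series with coefficients
  \<open>(-1)\<^sup>n b4 n\<close>. Two cases of the Jacobi triple product turn the product for \<^const>\<open>b4\<close> into
  \<open>B \<phi> = \<psi>\<close> (lemma \<open>b4_series_theta\<close>). As \<open>\<phi> = 1 + 2S\<close>, where \<open>S\<close> runs over the positive squares,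
  \<open>1 / \<phi>\<close> is a polynomial in \<open>S\<close> of degree 5 modulo 64. Comparing this polynomial with
  \<open>\<phi>\<^sup>3 = (1 + 2S)\<^sup>3\<close> and reducing the powers of \<open>S\<close> that remain by \<open>S\<^sup>2 = \<Sum> X\<^bsup>2x\<^sup>2\<^esup> + 2(\<dots>)\<close>, one gets
  modulo 64 (lemma \<open>b4_series_mod_64\<close>)
  \<open>B = - \<psi> \<phi>\<^sup>3 + a combination of \<psi> and of products \<psi> \<Sum> X\<^bsup>k x\<^sup>2\<^esup>, k \<in> {1, 2, 4}\<close>.

  Let \<open>N = 49 n + \<alpha>\<close>. Then \<open>8 N + 1 = 7 m\<close> with \<open>m = 7 (mod 8)\<close> and \<open>m\<close> prime to 7, and since
  \<open>8 (2j\<^sup>2 + j) + 1 = (4j + 1)\<^sup>2\<close> the \<open>N\<close>-th coefficients count representations of \<open>7 m\<close>. Those of the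
  second part vanish: \<open>a\<^sup>2 + 8 k x\<^sup>2\<close> is a sum of two squares modulo 7, so it is divisible by 49 as
  soon as it is divisible by 7 (lemma \<open>binary_coeff_0\<close>).

  The coefficient of \<open>\<psi> \<phi>\<^sup>3\<close> is half the number of solutions of
  \<open>a\<^sup>2 + 8 (x\<^sup>2 + y\<^sup>2 + z\<^sup>2) = 7 m\<close> with \<open>a\<close> odd. Modulo 7 the form is a sum of four squares, so its
  discriminant is a square and its totally isotropic planes fall into two families of eight, each nonzero
  isotropic vector lying on exactly one plane of each family. One family is permuted simply
  transitively by a group of eight signed permutations of \<open>x, y, z\<close>, which also permute the
  solutions. So the number of solutions is eight times the number of those on one plane (lemma
  \<open>card_reps_eq_8_times_plane\<close>). On that plane the form is 7 times an integral form, and an explicit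
  similitude identifies its solutions with those of \<open>p\<^sup>2 + 2w\<^sup>2 + 4 (r\<^sup>2 + s\<^sup>2) = m\<close>, \<open>p\<close> odd (lemma
  \<open>card_reps_in_plane_lattice\<close>). The number of the latter is divisible by 16 because sign changes and
  the exchange of \<open>r\<close> and \<open>s\<close> act freely. Hence \<open>128\<close> divides the number of solutions, \<open>64\<close> divides the
  coefficient of \<open>\<psi> \<phi>\<^sup>3\<close>, and so \<open>64\<close> divides \<open>b4 N\<close>.
\<close>

unbundle fps_syntax

section \<open>Power series agreeing up to a given order\<close>

definition agree_below :: "nat \<Rightarrow> 'a::comm_ring_1 fps \<Rightarrow> 'a fps \<Rightarrow> bool" where
  "agree_below N f g \<longleftrightarrow> (\<forall>i<N. f $ i = g $ i)"

lemma agree_below_refl [simp]: "agree_below N f f"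
  by (simp add: agree_below_def)

lemma agree_below_sym: "agree_below N f g \<Longrightarrow> agree_below N g f"
  by (simp add: agree_below_def)

lemma agree_below_trans [trans]:
  "agree_below N f g \<Longrightarrow> agree_below N g h \<Longrightarrow> agree_below N f h"
  by (simp add: agree_below_def)

lemma agree_below_mult:
  "agree_below N f f' \<Longrightarrow> agree_below N g g' \<Longrightarrow> agree_below N (f * g) (f' * g')"
  by (auto simp: agree_below_def fps_mult_nth intro!: sum.cong)

lemma agree_below_diff:
  "agree_below N f f' \<Longrightarrow> agree_below N g g' \<Longrightarrow> agree_below N (f - g) (f' - g')"
  by (simp add: agree_below_def)

lemma agree_below_sum:
  "(\<And>a. a \<in> A \<Longrightarrow> agree_below N (f a) (g a)) \<Longrightarrow> agree_below N (sum f A) (sum g A)"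
  by (auto simp: agree_below_def fps_sum_nth intro!: sum.cong)

lemma agree_below_power_ge:
  assumes "x $ 0 = 0" "N \<le> k"
  shows "agree_below N (x ^ k) 0"
  using assms unfolding agree_below_def by (auto simp: fps_power_zeroth startsby_zero_power_prefix)

section \<open>Gaussian binomials and the finite Jacobi triple product\<close>

fun qbinom :: "'a::comm_ring_1 \<Rightarrow> nat \<Rightarrow> nat \<Rightarrow> 'a" where
  "qbinom q n 0 = 1"
| "qbinom q 0 (Suc k) = 0"
| "qbinom q (Suc n) (Suc k) = qbinom q n k + q ^ Suc k * qbinom q n (Suc k)"

lemma qbinom_eq_0: "n < k \<Longrightarrow> qbinom q n k = 0"
  by (induction q n k rule: qbinom.induct) auto

definition q_pochhammer :: "'a::comm_ring_1 \<Rightarrow> nat \<Rightarrow> 'a" where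
  "q_pochhammer q n = (\<Prod>i<n. 1 - q ^ Suc i)"

lemma q_pochhammer_0 [simp]: "q_pochhammer q 0 = 1" by (simp add: q_pochhammer_def)
lemma q_pochhammer_Suc: "q_pochhammer q (Suc n) = q_pochhammer q n * (1 - q ^ Suc n)"
  by (simp add: q_pochhammer_def)

text \<open>The Gaussian binomial is the quotient of \<open>q\<close>-factorials. The equation is stated without division, so
that it makes sense in any commutative ring; it follows from the Pascal recursion, applied to both
neighbours \<open>(a - 1, b)\<close> and \<open>(a, b - 1)\<close>.\<close>

lemma qbinom_q_pochhammer: "qbinom q (a + b) a * q_pochhammer q a * q_pochhammer q b = q_pochhammer q (a + b)"
proof (induction "a + b" arbitrary: a b)
  case 0
  then show ?case by simp
next
  case (Suc n)
  show ?case
  proof (cases a)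
    case 0
    then show ?thesis by simp
  next
    case (Suc a')
    note a = this
    show ?thesis
    proof (cases b)
      case 0
      have "qbinom q k k = 1" for k by (induction k) (auto simp: qbinom_eq_0)
      then show ?thesis using 0 by simp
    next
      case (Suc b')
      have 1: "qbinom q (a' + b) a' * q_pochhammer q a' * q_pochhammer q b = q_pochhammer q (a' + b)"
        using Suc.hyps a by simp
      have 2: "qbinom q (a + b') a * q_pochhammer q a * q_pochhammer q b' = q_pochhammer q (a + b')"
        using Suc.hyps Suc by simp
      have e: "a + b' = a' + b" "a + b = Suc (a' + b)" using a Suc by auto
      have "qbinom q (a + b) a * q_pochhammer q a * q_pochhammer q b
        = qbinom q (a' + b) a' * q_pochhammer q a' * q_pochhammer q b * (1 - q ^ a)
          + q ^ a * (1 - q ^ b) * (qbinom q (a + b') a * q_pochhammer q a * q_pochhammer q b')"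
        using e a Suc by (simp add: q_pochhammer_Suc algebra_simps)
      also have "\<dots> = q_pochhammer q (a' + b) * (1 - q ^ (a + b))"
        unfolding 1 2 unfolding e(1) by (simp add: algebra_simps power_add)
      finally show ?thesis using e by (simp add: q_pochhammer_Suc)
    qed
  qed
qed

text \<open>Splitting off the factor \<open>y + x\<close> leaves a product of the same kind with \<open>x q\<close> for \<open>x\<close>, and the two
contributions to \<open>x\<^sup>k\<^sup>+\<^sup>1\<close> combine by the Pascal recursion. The homogeneous form, with \<open>y\<close>, stands in
for negative powers of the variable in the triple product below.\<close>

lemma q_binomial_theorem:
  "(\<Prod>i<n. y + x * q ^ i) =
     (\<Sum>k\<le>n. q ^ (k * (k - 1) div 2) * qbinom q n k * x ^ k * y ^ (n - k))"
proof (induction n arbitrary: x)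
  case 0
  then show ?case by simp
next
  case (Suc n)
  let ?c = "\<lambda>k::nat. k * (k - 1) div 2"
  let ?t = "\<lambda>n x k. q ^ ?c k * qbinom q n k * x ^ k * y ^ (n - k)"
  have c: "?c (Suc k) = ?c k + k" for k
  proof -
    have "even (k * (k - 1))" by (cases k) auto
    then show ?thesis by (cases k) (auto simp: algebra_simps elim!: evenE)
  qed
  have "(\<Prod>i<Suc n. y + x * q ^ i) = (y + x) * (\<Prod>i<n. y + (x * q) * q ^ i)"
    by (simp add: prod.lessThan_Suc_shift mult.assoc del: prod.lessThan_Suc)
  also have "\<dots> = (\<Sum>k\<le>n. y * ?t n (x * q) k) + (\<Sum>k\<le>n. x * ?t n (x * q) k)"
    unfolding Suc.IH by (simp only: distrib_right sum_distrib_left sum.distrib)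
  also have "(\<Sum>k\<le>n. y * ?t n (x * q) k) = (\<Sum>k\<le>Suc n. y * ?t n (x * q) k)"
    by (simp add: qbinom_eq_0)
  also have "\<dots> = y ^ Suc n + (\<Sum>k\<le>n. y * ?t n (x * q) (Suc k))"
    by (subst sum.atMost_Suc_shift) simp
  also have "y ^ Suc n + (\<Sum>k\<le>n. y * ?t n (x * q) (Suc k)) + (\<Sum>k\<le>n. x * ?t n (x * q) k)
     = y ^ Suc n + (\<Sum>k\<le>n. y * ?t n (x * q) (Suc k) + x * ?t n (x * q) k)"
    by (simp only: sum.distrib add.assoc)
  also have "(\<Sum>k\<le>n. y * ?t n (x * q) (Suc k) + x * ?t n (x * q) k) = (\<Sum>k\<le>n. ?t (Suc n) x (Suc k))"
  proof (rule sum.cong[OF refl])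
    fix k assume "k \<in> {..n}"
    show "y * ?t n (x * q) (Suc k) + x * ?t n (x * q) k = ?t (Suc n) x (Suc k)"
    proof (cases "k = n")
      case True
      have "qbinom q n (Suc n) = 0" by (simp add: qbinom_eq_0)
      then show ?thesis
        by (simp only: True c qbinom.simps diff_Suc_Suc power_mult_distrib power_add power_Suc) (simp add: algebra_simps)
    next
      case False
      with \<open>k \<in> {..n}\<close> have y: "y ^ (n - k) = y * y ^ (n - Suc k)"
        by (metis Suc_diff_Suc atMost_iff le_neq_implies_less power_Suc)
      show ?thesis
        by (simp only: c qbinom.simps diff_Suc_Suc y power_mult_distrib power_add power_Suc) (simp add: algebra_simps)
    qed
  qed
  also have "y ^ Suc n + \<dots> = (\<Sum>k\<le>Suc n. ?t (Suc n) x k)"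
    by (subst sum.atMost_Suc_shift) simp
  finally show ?case .
qed

text \<open>With \<open>q = x\<^sup>c\<close> and \<open>z = x\<^sup>b\<close> the general term \<open>q\<^bsup>j(j-1)/2\<^esup> z\<^sup>j\<close> of the Jacobi triple product is
\<open>x\<close> to this exponent.\<close>

definition theta_exp :: "nat \<Rightarrow> nat \<Rightarrow> int \<Rightarrow> nat" where
  "theta_exp b c j = nat (int c * (j * (j - 1) div 2) + int b * j)"

lemma theta_exp_bound_and_value:
  assumes "0 < b" "b < c"
  shows "nat \<bar>j\<bar> \<le> theta_exp b c j"
    and "int (theta_exp b c j) = int c * (j * (j - 1) div 2) + int b * j"
proof -
  define t where "t = j * (j - 1) div 2"
  have t: "2 * t = j * (j - 1)" unfolding t_def by simp
  have "0 \<le> j * (j - 1)"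
    by (cases "j \<le> 0") (auto simp: mult_nonpos_nonpos)
  then have t0: "0 \<le> t" using t by linarith
  have *: "\<bar>j\<bar> \<le> int c * t + int b * j"
  proof (cases "j \<ge> 0")
    case True
    then have "j \<le> int b * j" using assms mult_right_mono[of 1 "int b" j] by simp
    then show ?thesis using t0 True by (simp add: add_increasing)
  next
    case False
    then have "(- j) * 2 \<le> (- j) * (1 - j)" by (intro mult_left_mono) auto
    then have "- j \<le> t" using t by (simp add: algebra_simps)
    then have "int c * (- j) \<le> int c * t" by (intro mult_left_mono) auto
    moreover have "1 * (- j) \<le> (int c - int b) * (- j)"
      using assms False by (intro mult_right_mono) auto
    ultimately show ?thesis using False by (simp add: algebra_simps)
  qed
  then show "int (theta_exp b c j) = int c * (j * (j - 1) div 2) + int b * j"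
    unfolding theta_exp_def t_def by linarith
  then show "nat \<bar>j\<bar> \<le> theta_exp b c j" using * unfolding t_def by linarith
qed

text \<open>Take \<open>2n\<close> factors in the \<open>q\<close>-binomial theorem, with \<open>q = x\<^sup>c\<close>, and centre the sum at \<open>k = n\<close>. The usual
proof substitutes a negative power of \<open>x\<close>. Here the homogeneous form is used with \<open>y = x\<^sup>A\<close>,
\<open>A = c n - b\<close>, and the power of \<open>x\<close> common to both sides is cancelled at the end. The first \<open>n\<close> factors
\<open>x\<^sup>A - x\<^bsup>c i\<^esup>\<close> give the factors with \<open>c - b\<close> and the sign \<open>(-1)\<^sup>n\<close>, the others those with \<open>b\<close>.\<close>

lemma finite_jacobi_triple_product:
  fixes x :: "'a::idom"
  assumes "x \<noteq> 0" "0 < b" "b < c"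
  shows "(\<Prod>i<n. (1 - x ^ (b + c * i)) * (1 - x ^ (c - b + c * i))) =
    (\<Sum>k\<le>2*n. (-1) ^ (n + k) * qbinom (x ^ c) (2*n) k * x ^ theta_exp b c (int k - int n))"
proof (cases "n = 0")
  case True
  then show ?thesis by (simp add: theta_exp_def)
next
  case False
  define A where "A = c * n - b"
  have A: "int A = int c * int n - int b"
    using False assms unfolding A_def by (simp add: of_nat_diff le_trans[of b c "c * n"])
  let ?K = "c * (n * (n - 1) div 2) + n * A"
  have n2: "2 * (n * (n - 1) div 2) = n * (n - 1)" by (cases n) auto
  \<comment> \<open>The product, with the common power of \<open>x\<close> and the sign taken out of its factors.\<close>
  have "(\<Prod>i<2*n. x ^ A + (-1) * (x ^ c) ^ i) =
     (\<Prod>i<n. x ^ A + (-1) * (x ^ c) ^ i) * (\<Prod>i<n. x ^ A + (-1) * (x ^ c) ^ (n + i))"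
  proof -
    have "{..<2*n} = {..<n} \<union> (+) n ` {..<n}"
      by (auto simp: image_iff) (metis add_diff_inverse_nat lessThan_iff mult_2 nat_add_left_cancel_less)
    moreover have "{..<n} \<inter> (+) n ` {..<n} = {}" by auto
    ultimately show ?thesis
      by (simp add: prod.union_disjoint prod.reindex)
  qed
  also have "(\<Prod>i<n. x ^ A + (-1) * (x ^ c) ^ i) =
      (\<Prod>i<n. (-1) * ((x ^ c) ^ i * (1 - x ^ (c - b + c * (n - Suc i)))))"
  proof (rule prod.cong[OF refl])
    fix i assume "i \<in> {..<n}"
    then obtain d where d: "n = Suc i + d" by (metis less_iff_Suc_add lessThan_iff add_Suc)
    then have "n - Suc i = d" by simp
    then have "c * i + (c - b + c * (n - Suc i)) = A"
      using A assms by (simp only: flip: of_nat_eq_iff[where 'a=int]) (simp add: d of_nat_diff algebra_simps)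
    then have "x ^ A = (x ^ c) ^ i * x ^ (c - b + c * (n - Suc i))"
      by (simp flip: power_mult power_add)
    then show "x ^ A + (-1) * (x ^ c) ^ i = (-1) * ((x ^ c) ^ i * (1 - x ^ (c - b + c * (n - Suc i))))"
      by (simp add: algebra_simps)
  qed
  also have "\<dots> = (-1) ^ n * (\<Prod>i<n. x ^ (c * i)) * (\<Prod>i<n. 1 - x ^ (c - b + c * (n - Suc i)))"
    by (simp only: prod.distrib prod_constant card_lessThan power_mult mult.assoc)
  also have "(\<Prod>i<n. 1 - x ^ (c - b + c * (n - Suc i))) = (\<Prod>i<n. 1 - x ^ (c - b + c * i))"
    by (rule prod.nat_diff_reindex)
  also have "(\<Prod>i<n. x ^ (c * i)) = x ^ (c * (n * (n - 1) div 2))"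
  proof -
    have "2 * (\<Sum>i<n. i) = n * (n - 1)" for n :: nat
    proof (induction n)
      case (Suc n)
      then show ?case by (cases n) auto
    qed simp
    then have "(\<Sum>i<n. i) = n * (n - 1) div 2" using n2 by (metis nat_mult_eq_cancel1 zero_less_numeral)
    then show ?thesis by (simp flip: power_sum sum_distrib_left)
  qed
  also have "(\<Prod>i<n. x ^ A + (-1) * (x ^ c) ^ (n + i)) = (\<Prod>i<n. x ^ A * (1 - x ^ (b + c * i)))"
  proof (rule prod.cong[OF refl])
    fix i
    have "c * (n + i) = A + (b + c * i)"
      using A by (simp add: algebra_simps flip: of_nat_eq_iff[where 'a=int])
    then show "x ^ A + (-1) * (x ^ c) ^ (n + i) = x ^ A * (1 - x ^ (b + c * i))"
      by (simp add: algebra_simps flip: power_mult power_add)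
  qed
  also have "\<dots> = x ^ (n * A) * (\<Prod>i<n. 1 - x ^ (b + c * i))"
    by (simp add: prod.distrib power_mult mult.commute flip: power_mult)
  finally have lhs: "(\<Prod>i<2*n. x ^ A + (-1) * (x ^ c) ^ i) =
      (-1) ^ n * x ^ ?K * (\<Prod>i<n. (1 - x ^ (b + c * i)) * (1 - x ^ (c - b + c * i)))"
    by (simp only: prod.distrib power_add mult_ac)
  \<comment> \<open>The sum; centring it at \<open>n\<close> makes the same power of \<open>x\<close> a factor of every term.\<close>
  have "(\<Prod>i<2*n. x ^ A + (-1) * (x ^ c) ^ i) =
    (\<Sum>k\<le>2*n. (x ^ c) ^ (k * (k - 1) div 2) * qbinom (x ^ c) (2*n) k * (-1) ^ k * (x ^ A) ^ (2*n - k))"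
    by (rule q_binomial_theorem)
  also have "\<dots> = (\<Sum>k\<le>2*n. x ^ ?K * ((-1) ^ k * qbinom (x ^ c) (2*n) k * x ^ theta_exp b c (int k - int n)))"
  proof (rule sum.cong[OF refl])
    fix k assume k: "k \<in> {..2*n}"
    define j where "j = int k - int n"
    have k2: "2 * (k * (k - 1) div 2) = k * (k - 1)" by (cases k) auto
    have "2 * int (c * (k * (k - 1) div 2) + A * (2*n - k)) = 2 * int (?K + theta_exp b c j)"
    proof -
      have j2: "2 * (j * (j - 1) div 2) = j * (j - 1)" by simp
      have nn: "int (m * (m - 1)) = int m * (int m - 1)" for m by (cases m) (auto simp: algebra_simps)
      have "2 * int (c * (k * (k - 1) div 2) + A * (2*n - k))
          = int c * int (2 * (k * (k - 1) div 2)) + 2 * int A * (2 * int n - int k)"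
      proof -
        have "int (2*n - k) = 2 * int n - int k" using k by auto
        then show ?thesis by (simp only: of_nat_add of_nat_mult of_nat_numeral) (simp only: algebra_simps)
      qed
      also have "\<dots> = int c * (int k * (int k - 1)) + 2 * int A * (2 * int n - int k)"
        by (simp only: k2 nn)
      also have "\<dots> = int c * (int n * (int n - 1)) + 2 * (int n * int A) + (int c * (j * (j - 1)) + 2 * int b * j)"
        unfolding A j_def by (simp add: algebra_simps)
      also have "\<dots> = int c * int (2 * (n * (n - 1) div 2)) + 2 * (int n * int A)
           + (int c * (2 * (j * (j - 1) div 2)) + 2 * int b * j)"
        by (simp only: n2 j2 nn)
      also have "\<dots> = 2 * int (?K + theta_exp b c j)"
        by (simp only: of_nat_add of_nat_mult of_nat_numeral theta_exp_bound_and_value(2)[OF assms(2,3)])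
          (simp only: algebra_simps)
      finally show ?thesis .
    qed
    moreover have "u = v" if "2 * int u = 2 * int v" for u v :: nat using that by simp
    ultimately have "c * (k * (k - 1) div 2) + A * (2*n - k) = ?K + theta_exp b c j" by blast
    then have e: "(x ^ c) ^ (k * (k - 1) div 2) * (x ^ A) ^ (2*n - k) = x ^ ?K * x ^ theta_exp b c j"
      by (simp only: power_mult[symmetric] power_add[symmetric])
    have "(x ^ c) ^ (k * (k - 1) div 2) * qbinom (x ^ c) (2*n) k * (-1) ^ k * (x ^ A) ^ (2*n - k)
       = (x ^ c) ^ (k * (k - 1) div 2) * (x ^ A) ^ (2*n - k) * (qbinom (x ^ c) (2*n) k * (-1) ^ k)"
      by (simp only: mult_ac)
    then show "(x ^ c) ^ (k * (k - 1) div 2) * qbinom (x ^ c) (2*n) k * (-1) ^ k * (x ^ A) ^ (2*n - k) =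
        x ^ ?K * ((-1) ^ k * qbinom (x ^ c) (2*n) k * x ^ theta_exp b c (int k - int n))"
      unfolding e j_def by (simp only: mult_ac)
  qed
  also have "\<dots> = x ^ ?K * (\<Sum>k\<le>2*n. (-1) ^ k * qbinom (x ^ c) (2*n) k * x ^ theta_exp b c (int k - int n))"
    by (simp only: sum_distrib_left)
  finally have "x ^ ?K * ((-1) ^ n * (\<Prod>i<n. (1 - x ^ (b + c * i)) * (1 - x ^ (c - b + c * i))))
     = x ^ ?K * (\<Sum>k\<le>2*n. (-1) ^ k * qbinom (x ^ c) (2*n) k * x ^ theta_exp b c (int k - int n))"
    unfolding lhs by (simp only: mult_ac)
  from mult_left_cancel[OF power_not_zero[OF assms(1)], THEN iffD1, OF this] have eq: "(-1) ^ n * (\<Prod>i<n. (1 - x ^ (b + c * i)) * (1 - x ^ (c - b + c * i)))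
     = (\<Sum>k\<le>2*n. (-1) ^ k * qbinom (x ^ c) (2*n) k * x ^ theta_exp b c (int k - int n))"
    .
  have s: "(-1) ^ n * (-1) ^ n = (1::'a)" by (simp flip: power_mult_distrib)
  have "(\<Prod>i<n. (1 - x ^ (b + c * i)) * (1 - x ^ (c - b + c * i))) =
     (-1) ^ n * ((-1) ^ n * (\<Prod>i<n. (1 - x ^ (b + c * i)) * (1 - x ^ (c - b + c * i))))"
    by (simp only: mult.assoc[symmetric] s mult_1_left)
  also have "\<dots> = (-1) ^ n * (\<Sum>k\<le>2*n. (-1) ^ k * qbinom (x ^ c) (2*n) k * x ^ theta_exp b c (int k - int n))"
    by (simp only: eq)
  also have "\<dots> = (\<Sum>k\<le>2*n. (-1) ^ (n + k) * qbinom (x ^ c) (2*n) k * x ^ theta_exp b c (int k - int n))"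
    by (simp only: sum_distrib_left power_add mult.assoc)
  finally show ?thesis .
qed

lemma q_pochhammer_agree:
  fixes x :: "'a::comm_ring_1 fps"
  assumes "x $ 0 = 0" "0 < c" "N \<le> m"
  shows "agree_below N (q_pochhammer (x ^ c) m) (q_pochhammer (x ^ c) N)"
  using assms(3)
proof (induction m rule: dec_induct)
  case base
  then show ?case by simp
next
  case (step m)
  have "N \<le> c * Suc m" using step.hyps assms(2) by (cases c) auto
  then have "agree_below N (x ^ (c * Suc m)) 0" using agree_below_power_ge[OF assms(1)] by blast
  then have "agree_below N (1 - (x ^ c) ^ Suc m) (1 - 0)"
    by (intro agree_below_diff) (simp_all only: agree_below_refl power_mult)
  from agree_below_mult[OF step.IH this] show ?case by (simp add: q_pochhammer_Suc)
qed

lemma ex_fps_inverse: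
  fixes f :: "'a::comm_ring_1 fps"
  assumes "f $ 0 = 1"
  shows "\<exists>g. f * g = 1"
  using fps_left_inverse[of 1 f] assms by (metis mult.commute mult_1)

text \<open>The central Gaussian binomials tend to \<open>1 / \<Prod> (1 - q\<^sup>i)\<close> in the \<open>X\<close>-adic topology: up to order \<open>N\<close> the
three \<open>q\<close>-factorials in the quotient formula all agree.\<close>

lemma qbinom_agree:
  fixes x :: "'a::comm_ring_1 fps"
  assumes x: "x $ 0 = 0" and c: "0 < c" and "N \<le> a" "N \<le> b" "N \<le> m"
  shows "agree_below N (qbinom (x ^ c) (a + b) a * q_pochhammer (x ^ c) m) 1"
proof -
  let ?E = "\<lambda>n. q_pochhammer (x ^ c) n"
  let ?G = "qbinom (x ^ c) (a + b) a"
  note E = q_pochhammer_agree[OF x c]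
  have "(?E N) $ 0 = 1"
    using x c by (induction N) (auto simp: q_pochhammer_Suc fps_power_zeroth power_0_left)
  then obtain I where I: "?E N * I = 1" using ex_fps_inverse by blast
  have "agree_below N (?G * ?E m) (?G * ?E N * 1)"
    using agree_below_mult[OF agree_below_refl E[OF assms(5)]] by simp
  also have "?G * ?E N * 1 = ?G * ?E N * ?E N * I"
    using I by (simp add: mult.assoc)
  also have "agree_below N (?G * ?E N * ?E N * I) (?G * ?E a * ?E b * I)"
    by (intro agree_below_mult agree_below_refl agree_below_sym[OF E] assms)
  also have "?G * ?E a * ?E b * I = ?E (a + b) * I"
    by (simp add: qbinom_q_pochhammer)
  also have "agree_below N (?E (a + b) * I) (?E N * I)"
    using assms by (intro agree_below_mult agree_below_refl E) auto
  finally show ?thesis using I by simp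
qed

text \<open>The terms of the finite identity with both \<open>k\<close> and \<open>2n - k\<close> large have Gaussian binomials
close to the limit; the remaining ones have \<open>\<bar>k - n\<bar> \<ge> N\<close>, which forces a high power of \<open>x\<close>.\<close>

lemma jacobi_triple_product_truncated:
  fixes x :: "'a::idom fps"
  assumes "x \<noteq> 0" and x0: "x $ 0 = 0" and b: "0 < b" "b < c" and n: "2 * N \<le> n"
  shows "agree_below N
    ((\<Prod>i<n. (1 - x ^ (b + c * i)) * (1 - x ^ (c - b + c * i))) * q_pochhammer (x ^ c) n)
    (\<Sum>j\<in>{- int n..int n}. (-1) ^ nat \<bar>j\<bar> * x ^ theta_exp b c j)"
proof -
  have "agree_below N
     (\<Sum>k\<le>2*n. (-1) ^ (n + k) * qbinom (x ^ c) (2*n) k * x ^ theta_exp b c (int k - int n) * q_pochhammer (x ^ c) n)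
     (\<Sum>k\<le>2*n. (-1) ^ (n + k) * x ^ theta_exp b c (int k - int n))"
  proof (rule agree_below_sum)
    fix k assume k: "k \<in> {..2*n}"
    let ?s = "(-1) ^ (n + k) :: 'a fps"
    let ?y = "x ^ theta_exp b c (int k - int n)"
    show "agree_below N (?s * qbinom (x ^ c) (2*n) k * ?y * q_pochhammer (x ^ c) n) (?s * ?y)"
    proof (cases "N \<le> k \<and> N \<le> 2*n - k")
      case True
      then have "agree_below N (qbinom (x ^ c) (2*n) k * q_pochhammer (x ^ c) n) 1"
        using qbinom_agree[OF x0, of c N k "2*n - k" n] b n k by simp
      from agree_below_mult[OF agree_below_refl[of N "?s * ?y"] this]
      show ?thesis by (simp only: mult_ac mult_1_right mult_1_left)
    next
      case False
      then have "N \<le> nat \<bar>int k - int n\<bar>" using n k by auto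
      then have "N \<le> theta_exp b c (int k - int n)"
        using theta_exp_bound_and_value(1)[OF b, of "int k - int n"] by linarith
      then have y: "agree_below N ?y 0" by (rule agree_below_power_ge[OF x0])
      have "agree_below N (?s * qbinom (x ^ c) (2*n) k * q_pochhammer (x ^ c) n * ?y) 0"
        using agree_below_mult[OF agree_below_refl y] by simp
      also have "agree_below N 0 (?s * ?y)"
        using agree_below_mult[OF agree_below_refl y] by (simp add: agree_below_sym)
      finally show ?thesis by (simp only: mult_ac)
    qed
  qed
  also have "(\<Sum>k\<le>2*n. (-1) ^ (n + k) * x ^ theta_exp b c (int k - int n)) =
     (\<Sum>j\<in>{- int n..int n}. (-1) ^ nat \<bar>j\<bar> * x ^ theta_exp b c j)"
    by (rule sum.reindex_bij_witness[of _ "\<lambda>j. nat (j + int n)" "\<lambda>k. int k - int n"])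
       (auto simp: minus_one_power_iff even_nat_iff)
  finally show ?thesis
    using finite_jacobi_triple_product[OF assms(1) b, of n] by (simp add: sum_distrib_right)
qed

section \<open>Generating functions of weighted sets\<close>

definition finite_fibres :: "'a set \<Rightarrow> ('a \<Rightarrow> nat) \<Rightarrow> bool" where
  "finite_fibres A w \<longleftrightarrow> (\<forall>n. finite {a \<in> A. w a = n})"

text \<open>Without \<^const>\<open>finite_fibres\<close> a coefficient can be the value 0 that \<^const>\<open>card\<close> assigns to an infinite
set.\<close>

definition gf :: "'a set \<Rightarrow> ('a \<Rightarrow> nat) \<Rightarrow> int fps" where
  "gf A w = Abs_fps (\<lambda>n. int (card {a \<in> A. w a = n}))"

lemma gf_nth: "gf A w $ n = int (card {a \<in> A. w a = n})"
  by (simp add: gf_def)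

lemma finite_fibres_subset:
  assumes "finite_fibres A w" "B \<subseteq> A"
  shows "finite_fibres B w"
  unfolding finite_fibres_def
proof
  fix n
  have "{b \<in> B. w b = n} \<subseteq> {a \<in> A. w a = n}" using assms(2) by blast
  then show "finite {b \<in> B. w b = n}"
    by (rule finite_subset) (use assms(1) in \<open>simp add: finite_fibres_def\<close>)
qed

lemma finite_fibres_Times:
  assumes "finite_fibres A v" "finite_fibres B w"
  shows "finite_fibres (A \<times> B) (\<lambda>(a, b). v a + w b)"
  unfolding finite_fibres_def
proof
  fix n
  have "{p \<in> A \<times> B. (\<lambda>(a, b). v a + w b) p = n} \<subseteq>
     (\<Union>i\<le>n. {a \<in> A. v a = i}) \<times> (\<Union>i\<le>n. {b \<in> B. w b = i})"
    by auto
  moreover have "finite \<dots>" using assms by (auto simp: finite_fibres_def)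
  ultimately show "finite {p \<in> A \<times> B. (\<lambda>(a, b). v a + w b) p = n}"
    by (rule finite_subset)
qed

lemma gf_Times:
  assumes "finite_fibres A v" "finite_fibres B w"
  shows "gf (A \<times> B) (\<lambda>(a, b). v a + w b) = gf A v * gf B w"
proof (rule fps_ext)
  fix n
  have "{p \<in> A \<times> B. (\<lambda>(a, b). v a + w b) p = n} =
     (\<Union>i\<in>{0..n}. {a \<in> A. v a = i} \<times> {b \<in> B. w b = n - i})"
    by auto
  moreover have "card (\<Union>i\<in>{0..n}. {a \<in> A. v a = i} \<times> {b \<in> B. w b = n - i}) =
     (\<Sum>i\<in>{0..n}. card ({a \<in> A. v a = i} \<times> {b \<in> B. w b = n - i}))"
    using assms by (intro card_UN_disjoint) (auto simp: finite_fibres_def)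
  ultimately show "gf (A \<times> B) (\<lambda>(a, b). v a + w b) $ n = (gf A v * gf B w) $ n"
    by (simp add: gf_nth fps_mult_nth card_cartesian_product)
qed

lemma gf_Un:
  assumes "finite_fibres A w" "finite_fibres B w" "A \<inter> B = {}"
  shows "gf (A \<union> B) w = gf A w + gf B w"
proof (rule fps_ext)
  fix n
  have "{a \<in> A \<union> B. w a = n} = {a \<in> A. w a = n} \<union> {a \<in> B. w a = n}" by auto
  then show "gf (A \<union> B) w $ n = (gf A w + gf B w) $ n"
    using assms by (auto simp: gf_nth finite_fibres_def card_Un_disjoint disjoint_iff)
qed

lemma gf_bij:
  assumes "bij_betw h A B" "\<And>a. a \<in> A \<Longrightarrow> w (h a) = v a"
  shows "gf A v = gf B w"
proof (rule fps_ext)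
  fix n
  have "bij_betw h {a \<in> A. v a = n} {b \<in> B. w b = n}"
    using assms by (auto simp: bij_betw_def inj_on_def)
  then show "gf A v $ n = gf B w $ n" by (simp add: gf_nth bij_betw_same_card)
qed

text \<open>Pairs off the diagonal come in couples \<open>(a, b)\<close>, \<open>(b, a)\<close>: the square of a series is, modulo 2, the
series with doubled weights.\<close>

lemma gf_square:
  fixes w :: "'a::linorder \<Rightarrow> nat"
  assumes "finite_fibres A w"
  shows "\<exists>u. gf A w ^ 2 = gf A (\<lambda>a. 2 * w a) + 2 * u"
proof -
  let ?w = "\<lambda>(a, b). w a + w b"
  let ?L = "{p \<in> A \<times> A. fst p < snd p}" and ?G = "{p \<in> A \<times> A. snd p < fst p}"
  let ?D = "{p \<in> A \<times> A. fst p = snd p}"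
  have f: "finite_fibres (A \<times> A) ?w" using assms by (rule finite_fibres_Times[OF _ assms])
  have "A \<times> A = ?D \<union> (?L \<union> ?G)" by auto
  then have "gf A w ^ 2 = gf (?D \<union> (?L \<union> ?G)) ?w"
    using gf_Times[OF assms assms] by (simp add: power2_eq_square)
  also have "\<dots> = gf ?D ?w + gf (?L \<union> ?G) ?w"
    by (rule gf_Un) (auto intro: finite_fibres_subset[OF f])
  also have "gf (?L \<union> ?G) ?w = gf ?L ?w + gf ?G ?w"
    by (rule gf_Un) (auto intro: finite_fibres_subset[OF f])
  also have "gf ?G ?w = gf ?L ?w"
  proof (rule gf_bij)
    show "bij_betw prod.swap ?G ?L" by (rule bij_betwI[of _ _ _ prod.swap]) auto
  qed auto
  also have "gf ?D ?w = gf A (\<lambda>a. 2 * w a)"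
  proof (rule gf_bij)
    show "bij_betw fst ?D A" by (rule bij_betwI[of _ _ _ "\<lambda>a. (a, a)"]) auto
  qed auto
  finally have "gf A w ^ 2 = gf A (\<lambda>a. 2 * w a) + 2 * gf ?L ?w" by simp
  then show ?thesis ..
qed

text \<open>Multisets that contain a given part \<open>a\<close> correspond, by removing one copy of \<open>a\<close>, to arbitrary
multisets of weight smaller by \<open>a\<close>. This multiplies the generating function by \<open>1 / (1 - X\<^sup>a)\<close> for
every part that is allowed. Finiteness of the fibres is carried along for the disjoint unions.\<close>

lemma gf_multisets:
  assumes "finite A" "0 \<notin> A"
  shows "(\<Prod>a\<in>A. 1 - fps_X ^ a) * gf {M. set_mset M \<subseteq> A} sum_mset = 1 \<and>
     finite_fibres {M. set_mset M \<subseteq> A} sum_mset"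
  using assms
proof (induction A rule: finite_induct)
  case empty
  have "{M. set_mset M \<subseteq> ({}::nat set)} = {{#}}" by simp
  moreover have "gf {{#}} sum_mset = 1"
  proof (rule fps_ext)
    fix n :: nat
    have "{M \<in> {{#}}. sum_mset M = n} = (if n = 0 then {{#}} else {})" by auto
    then show "gf {{#}} sum_mset $ n = 1 $ n" by (simp add: gf_nth)
  qed
  moreover have "finite_fibres {{#}} (sum_mset :: nat multiset \<Rightarrow> nat)"
    by (simp add: finite_fibres_def)
  ultimately show ?case by simp
next
  case (insert a A)
  let ?P = "{M. set_mset M \<subseteq> A}" and ?Q = "{M. set_mset M \<subseteq> insert a A}"
  have fin: "finite_fibres ?Q sum_mset"
    unfolding finite_fibres_def
  proof
    fix n
    have "{M \<in> ?Q. sum_mset M = n} \<subseteq> partitions n"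
      using insert.prems by (auto simp: partitions_def)
    then show "finite {M \<in> ?Q. sum_mset M = n}" by (rule finite_subset) (rule finite_partitions)
  qed
  let ?R = "{M \<in> ?Q. a \<in># M}"
  have "?Q = ?P \<union> ?R" by auto
  then have "gf ?Q sum_mset = gf (?P \<union> ?R) sum_mset" by (rule arg_cong)
  also have "\<dots> = gf ?P sum_mset + gf ?R sum_mset"
  proof (rule gf_Un)
    show "finite_fibres ?R sum_mset" by (rule finite_fibres_subset[OF fin]) auto
    show "?P \<inter> ?R = {}" using insert.hyps by auto
    show "finite_fibres ?P sum_mset" by (rule finite_fibres_subset[OF fin]) auto
  qed
  also have "gf ?R sum_mset = fps_X ^ a * gf ?Q sum_mset"
  proof (rule fps_ext)
    fix n
    have "bij_betw (add_mset a) {M \<in> ?Q. a + sum_mset M = n} {M \<in> ?R. sum_mset M = n}"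
    proof (rule bij_betw_imageI)
      show "inj_on (add_mset a) {M \<in> ?Q. a + sum_mset M = n}" by (simp add: inj_on_def)
      show "add_mset a ` {M \<in> ?Q. a + sum_mset M = n} = {M \<in> ?R. sum_mset M = n}"
      proof (intro equalityI subsetI)
        fix M assume M: "M \<in> {M \<in> ?R. sum_mset M = n}"
        then have "a \<in># M" by simp
        then obtain K where "M = add_mset a K" using multi_member_split[of a M] by blast
        with M show "M \<in> add_mset a ` {M \<in> ?Q. a + sum_mset M = n}" by auto
      qed auto
    qed
    then have "card {M \<in> ?R. sum_mset M = n} = card {M \<in> ?Q. a + sum_mset M = n}"
      by (simp add: bij_betw_same_card)
    also have "\<dots> = (if n < a then 0 else card {M \<in> ?Q. sum_mset M = n - a})"
    proof (cases "n < a")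
      case True
      then have "{M \<in> ?Q. a + sum_mset M = n} = {}" by auto
      then show ?thesis using True by simp
    next
      case False
      then have "a + sum_mset M = n \<longleftrightarrow> sum_mset M = n - a" for M by auto
      then show ?thesis using False by simp
    qed
    finally show "gf ?R sum_mset $ n = (fps_X ^ a * gf ?Q sum_mset) $ n"
      by (simp add: gf_nth fps_X_power_mult_nth)
  qed
  finally have "(1 - fps_X ^ a) * gf ?Q sum_mset = gf ?P sum_mset"
    unfolding left_diff_distrib mult_1_left diff_eq_eq .
  moreover have "(\<Prod>b\<in>insert a A. 1 - fps_X ^ b) * gf ?Q sum_mset =
      (\<Prod>b\<in>A. 1 - fps_X ^ b) * ((1 - fps_X ^ a) * gf ?Q sum_mset)"
    by (simp only: prod.insert[OF insert.hyps] mult_ac)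
  ultimately show ?case using insert.IH insert.prems fin by simp
qed

section \<open>The theta quotient of the 4-regular partition function\<close>

definition sq :: "int \<Rightarrow> nat" where "sq x = nat (x\<^sup>2)"
definition tri :: "int \<Rightarrow> nat" where "tri j = nat (2 * j\<^sup>2 + j)"

lemma abs_le_square: "\<bar>x\<bar> \<le> x\<^sup>2" for x :: int
proof (cases "x = 0")
  case False
  then have "\<bar>x\<bar> * 1 \<le> \<bar>x\<bar> * \<bar>x\<bar>" by (intro mult_left_mono) auto
  then show ?thesis by (simp add: power2_eq_square flip: abs_mult)
qed simp

lemma of_nat_sq: "int (sq x) = x\<^sup>2" by (simp add: sq_def)
lemma of_nat_tri: "int (tri x) = 2 * x\<^sup>2 + x"
  using abs_le_square[of x] by (simp add: tri_def)

lemma theta_exp_sq: "theta_exp 1 2 j = sq j"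
proof -
  have "2 * (j * (j - 1) div 2) = j * (j - 1)" by simp
  then have "2 * (j * (j - 1) div 2) + j = j\<^sup>2"
    by (simp add: algebra_simps power2_eq_square)
  then show ?thesis by (simp add: theta_exp_def sq_def)
qed

lemma theta_exp_tri: "theta_exp 3 4 j = tri j"
proof -
  define t where "t = j * (j - 1) div 2"
  have "2 * t = j * j - j" unfolding t_def by (simp add: algebra_simps)
  then have "4 * t + 3 * j = 2 * j\<^sup>2 + j"
    by (simp add: power2_eq_square)
  then show ?thesis by (simp add: theta_exp_def tri_def t_def)
qed

lemma finite_fibres_int:
  assumes "\<And>j::int. nat \<bar>j\<bar> \<le> w j"
  shows "finite_fibres A w"
  unfolding finite_fibres_def
proof
  fix n
  have "{a \<in> A. w a = n} \<subseteq> {- int n..int n}"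
  proof
    fix a assume "a \<in> {a \<in> A. w a = n}"
    then have "nat \<bar>a\<bar> \<le> n" using assms[of a] by simp
    then show "a \<in> {- int n..int n}" by auto
  qed
  then show "finite {a \<in> A. w a = n}" by (rule finite_subset) simp
qed

lemma gf_truncated:
  assumes "\<And>j::int. nat \<bar>j\<bar> \<le> w j" "N \<le> n"
  shows "agree_below N (\<Sum>j\<in>{- int n..int n}. fps_X ^ w j) (gf UNIV w)"
  unfolding agree_below_def
proof (intro allI impI)
  fix i assume "i < N"
  have "{j \<in> {- int n..int n}. w j = i} = {j. w j = i}"
  proof -
    have "j \<in> {- int n..int n}" if "w j = i" for j
      using assms(1)[of j] assms(2) \<open>i < N\<close> that by auto
    then show ?thesis by blast
  qed
  moreover have "(\<Sum>j\<in>{- int n..int n}. fps_X ^ w j) $ i = (\<Sum>j\<in>{- int n..int n}. if w j = i then 1 else 0 :: int)"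
    by (auto simp: fps_sum_nth fps_X_power_nth intro!: sum.cong)
  moreover have "\<dots> = int (card {j \<in> {- int n..int n}. w j = i})"
    by (simp add: sum.If_cases Int_def)
  ultimately show "(\<Sum>j\<in>{- int n..int n}. fps_X ^ w j) $ i = gf UNIV w $ i"
    by (simp add: gf_nth)
qed

text \<open>At \<open>x = - X\<close> the signs of the triple product cancel when the exponent has the parity of \<open>j\<close>, and
what remains is a counting series.\<close>

lemma theta_product:
  assumes b: "0 < b" "b < c" and par: "\<And>j. even (theta_exp b c j) \<longleftrightarrow> even j" and n: "2 * N \<le> n"
  defines "x \<equiv> - fps_X :: int fps"
  shows "agree_below N
    ((\<Prod>i<n. (1 - x ^ (b + c * i)) * (1 - x ^ (c - b + c * i))) * q_pochhammer (x ^ c) n)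
    (gf UNIV (theta_exp b c))"
proof -
  have "(-1) ^ nat \<bar>j\<bar> * x ^ theta_exp b c j = fps_X ^ theta_exp b c j" for j
  proof -
    have "even (nat \<bar>j\<bar>) = even (theta_exp b c j)" by (simp add: par even_nat_iff)
    then have "(-1) ^ nat \<bar>j\<bar> = (-1 :: int fps) ^ theta_exp b c j"
      by (simp add: minus_one_power_iff)
    then show ?thesis unfolding x_def by (simp flip: power_mult_distrib)
  qed
  then have "agree_below N
    ((\<Prod>i<n. (1 - x ^ (b + c * i)) * (1 - x ^ (c - b + c * i))) * q_pochhammer (x ^ c) n)
    (\<Sum>j\<in>{- int n..int n}. fps_X ^ theta_exp b c j)"
    using jacobi_triple_product_truncated[OF _ _ b n, of x] by (simp add: x_def)
  also have "agree_below N \<dots> (gf UNIV (theta_exp b c))"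
    by (rule gf_truncated[OF theta_exp_bound_and_value(1)[OF b]]) (use n in auto)
  finally show ?thesis .
qed

text \<open>The signs are those of the substitution of \<open>- X\<close> for \<open>X\<close>; they make both theta series below
generating functions with nonnegative coefficients.\<close>

definition b4_series :: "int fps" where
  "b4_series = Abs_fps (\<lambda>n. (-1) ^ n * int (b4 n))"

lemma b4_series_product:
  defines "x \<equiv> - fps_X :: int fps"
  assumes "N \<le> n"
  shows "agree_below N (b4_series *
    ((\<Prod>i<n. 1 - x ^ (1 + 4 * i)) * (\<Prod>i<n. 1 - x ^ (2 + 4 * i)) * (\<Prod>i<n. 1 - x ^ (3 + 4 * i)))) 1"
proof -
  let ?A = "\<lambda>r. (\<lambda>i. r + 4 * i) ` {..<n}"
  define A where "A = ?A 1 \<union> (?A 2 \<union> ?A 3)"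
  have fin: "finite A" and 0: "0 \<notin> A" by (auto simp: A_def)
  let ?P = "{M. set_mset M \<subseteq> A}"
  have mem: "a \<in> A \<longleftrightarrow> a < 4 * n \<and> \<not> 4 dvd a" for a
  proof
    assume a: "a < 4 * n \<and> \<not> 4 dvd a"
    then have "a div 4 < n" by linarith
    moreover have "a = 1 + 4 * (a div 4) \<or> a = 2 + 4 * (a div 4) \<or> a = 3 + 4 * (a div 4)"
      using a by presburger
    ultimately show "a \<in> A" unfolding A_def by blast
  next
    assume "a \<in> A"
    then obtain i r where "i < n" "a = r + 4 * i" "r = 1 \<or> r = 2 \<or> r = 3"
      unfolding A_def by blast
    then show "a < 4 * n \<and> \<not> 4 dvd a" by presburger
  qed
  have prod: "(\<Prod>a\<in>A. 1 - x ^ a) =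
     (\<Prod>i<n. 1 - x ^ (1 + 4 * i)) * ((\<Prod>i<n. 1 - x ^ (2 + 4 * i)) * (\<Prod>i<n. 1 - x ^ (3 + 4 * i)))"
  proof -
    have "?A 1 \<inter> (?A 2 \<union> ?A 3) = {}" "?A 2 \<inter> ?A 3 = {}" by (auto; presburger)+
    then show ?thesis unfolding A_def
      by (simp add: prod.union_disjoint prod.reindex inj_on_def)
  qed
  have "((\<Prod>a\<in>A. 1 - fps_X ^ a) * gf ?P sum_mset) oo x = 1 oo x"
    using gf_multisets[OF fin 0] by simp
  then have "(\<Prod>a\<in>A. 1 - x ^ a) * (gf ?P sum_mset oo x) = 1"
    by (simp add: x_def fps_compose_mult_distrib fps_compose_prod_distrib fps_compose_sub_distrib
        flip: fps_compose_power)
  moreover have "agree_below N b4_series (gf ?P sum_mset oo x)"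
    unfolding agree_below_def
  proof (intro allI impI)
    fix i assume "i < N"
    have "M \<in> regular_partitions 4 i \<longleftrightarrow> M \<in> ?P \<and> sum_mset M = i" for M
    proof -
      have "a \<le> i" if "a \<in># M" "sum_mset M = i" for a
        using that by (metis le_add1 multi_member_split sum_mset.add_mset)
      then show ?thesis using \<open>i < N\<close> assms(2)
        by (fastforce simp: regular_partitions_def partitions_def mem subset_iff)
    qed
    then have "regular_partitions 4 i = {M \<in> ?P. sum_mset M = i}" by blast
    then show "b4_series $ i = (gf ?P sum_mset oo x) $ i"
      by (simp add: b4_series_def x_def fps_compose_uminus' gf_nth b4_def)
  qed
  ultimately show ?thesis
    using agree_below_mult[of N b4_series "gf ?P sum_mset oo x" "\<Prod>a\<in>A. 1 - x ^ a" "\<Prod>a\<in>A. 1 - x ^ a"]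
    unfolding prod by (simp add: mult_ac)
qed

text \<open>Write \<open>p\<^sub>r\<close> for the product of all \<open>1 - x\<^sup>a\<close> with \<open>a = r (mod 4)\<close>, at \<open>x = - X\<close>. The triple product gives
\<open>(p\<^sub>1 p\<^sub>3)\<^sup>2 p\<^sub>2 p\<^sub>4\<close> for the sum over squares and \<open>p\<^sub>1 p\<^sub>3 p\<^sub>4\<close> for the other sum, and the quotient
\<open>1 / (p\<^sub>1 p\<^sub>2 p\<^sub>3)\<close> of the two is the product for 4-regular partitions.\<close>

theorem b4_series_theta: "b4_series * gf UNIV sq = gf UNIV tri"
proof (rule fps_ext)
  fix m
  define N n where "N = Suc m" and "n = 2 * N"
  define x where "x = (- fps_X :: int fps)"
  let ?p = "\<lambda>r. \<Prod>i<n. 1 - x ^ (r + 4 * i)"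
  have even_odd: "(\<Prod>i<2*k. f i) = (\<Prod>i<k. f (2*i)) * (\<Prod>i<k. f (2*i+1))" for k and f :: "nat \<Rightarrow> int fps"
    by (induction k) (simp_all add: mult_ac)
  have theta_exp_eq: "theta_exp 1 2 = sq" "theta_exp 3 4 = tri"
    by (rule ext, rule theta_exp_sq, rule ext, rule theta_exp_tri)
  have par: "even (sq j) \<longleftrightarrow> even j" "even (tri j) \<longleftrightarrow> even j" for j
    using of_nat_sq[of j] of_nat_tri[of j]
    by (metis even_of_nat even_power zero_less_numeral, metis even_add even_mult_iff even_of_nat even_numeral)
  have sq: "agree_below N ((?p 1 * ?p 3)\<^sup>2 * (?p 2 * ?p 4)) (gf UNIV sq)"
  proof -
    have e: "1 + 2 * (2 * i) = 1 + 4 * i" "1 + 2 * (2 * i + 1) = 3 + 4 * i"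
      "2 - 1 + 2 * (2 * i) = 1 + 4 * i" "2 - 1 + 2 * (2 * i + 1) = 3 + 4 * i"
      "2 * Suc (2 * i) = 2 + 4 * i" "2 * Suc (2 * i + 1) = 4 + 4 * i" for i :: nat by simp_all
    have "agree_below N
      ((\<Prod>i<2*n. (1 - x ^ (1 + 2 * i)) * (1 - x ^ (2 - 1 + 2 * i))) * q_pochhammer (x ^ 2) (2*n))
      (gf UNIV (theta_exp 1 2))"
      unfolding x_def by (rule theta_product) (simp_all only: theta_exp_sq par, simp_all add: n_def)
    moreover have "(\<Prod>i<2*n. (1 - x ^ (1 + 2 * i)) * (1 - x ^ (2 - 1 + 2 * i))) = (?p 1 * ?p 3)\<^sup>2"
      unfolding even_odd e by (simp only: prod.distrib power2_eq_square mult_ac)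
    moreover have "q_pochhammer (x ^ 2) (2*n) = ?p 2 * ?p 4"
      unfolding even_odd q_pochhammer_def power_mult[symmetric] e ..
    ultimately show ?thesis by (simp only: theta_exp_eq)
  qed
  have tri: "agree_below N (?p 1 * ?p 3 * ?p 4) (gf UNIV tri)"
  proof -
    have "agree_below N
      ((\<Prod>i<n. (1 - x ^ (3 + 4 * i)) * (1 - x ^ (4 - 3 + 4 * i))) * q_pochhammer (x ^ 4) n)
      (gf UNIV (theta_exp 3 4))"
      unfolding x_def by (rule theta_product) (simp_all only: theta_exp_tri par, simp_all add: n_def)
    moreover have "q_pochhammer (x ^ 4) n = ?p 4"
      unfolding q_pochhammer_def power_mult[symmetric] by (simp add: algebra_simps)
    ultimately show ?thesis
      by (simp only: theta_exp_eq prod.distrib diff_numeral_simps) (simp add: mult_ac)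
  qed
  have b4: "agree_below N (b4_series * (?p 1 * ?p 2 * ?p 3)) 1"
    unfolding x_def by (rule b4_series_product) (simp add: n_def)
  have "agree_below N (b4_series * gf UNIV sq) (b4_series * ((?p 1 * ?p 3)\<^sup>2 * (?p 2 * ?p 4)))"
    by (intro agree_below_mult agree_below_refl agree_below_sym[OF sq])
  also have "b4_series * ((?p 1 * ?p 3)\<^sup>2 * (?p 2 * ?p 4)) =
     (b4_series * (?p 1 * ?p 2 * ?p 3)) * (?p 1 * ?p 3 * ?p 4)"
    by (simp only: power2_eq_square mult_ac)
  also have "agree_below N \<dots> (1 * gf UNIV tri)"
    by (intro agree_below_mult b4 tri)
  finally show "(b4_series * gf UNIV sq) $ m = gf UNIV tri $ m"
    by (simp add: agree_below_def N_def)
qed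

section \<open>Dissection of theta series and reduction modulo 64\<close>

lemma finite_fibres_sq: "0 < k \<Longrightarrow> finite_fibres A (\<lambda>x. k * sq x)"
proof (rule finite_fibres_int)
  fix j :: int assume "0 < k"
  have "nat \<bar>j\<bar> \<le> sq j" unfolding sq_def by (intro nat_mono abs_le_square)
  also have "\<dots> \<le> k * sq j" using \<open>0 < k\<close> by simp
  finally show "nat \<bar>j\<bar> \<le> k * sq j" .
qed

lemma finite_fibres_tri: "finite_fibres A tri"
proof (rule finite_fibres_int)
  fix j :: int
  show "nat \<bar>j\<bar> \<le> tri j" using abs_le_square[of j] unfolding tri_def by linarith
qed

lemma sq_minus [simp]: "sq (- x) = sq x" by (simp add: sq_def)
lemma sq_0 [simp]: "sq 0 = 0" by (simp add: sq_def)
lemma sq_double: "sq (2 * x) = 4 * sq x" by (simp add: sq_def power_mult_distrib nat_mult_distrib)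

lemma gf_symmetric:
  assumes "\<And>x. x \<in> A \<longleftrightarrow> - x \<in> A" "0 < k" "0 \<notin> A"
  shows "gf A (\<lambda>x. k * sq x) = 2 * gf {x \<in> A. 0 < x} (\<lambda>x. k * sq x)"
proof -
  let ?w = "\<lambda>x. k * sq x"
  have "A = {x \<in> A. 0 < x} \<union> {x \<in> A. x < 0}"
  proof -
    have "x \<noteq> 0" if "x \<in> A" for x using assms(3) that by blast
    then show ?thesis by (auto simp: not_less order_less_le)
  qed
  then have "gf A ?w = gf ({x \<in> A. 0 < x} \<union> {x \<in> A. x < 0}) ?w" by (rule arg_cong)
  also have "\<dots> = gf {x \<in> A. 0 < x} ?w + gf {x \<in> A. x < 0} ?w"
    by (rule gf_Un) (auto intro: finite_fibres_sq[OF assms(2)])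
  also have "gf {x \<in> A. x < 0} ?w = gf {x \<in> A. 0 < x} ?w"
  proof (rule gf_bij)
    show "bij_betw uminus {x \<in> A. x < 0} {x \<in> A. 0 < x}"
      by (rule bij_betwI[of _ _ _ uminus]) (use assms(1) in auto)
  qed simp
  finally show ?thesis by simp
qed

lemma gf_zero: "gf {0} (\<lambda>x. k * sq x) = 1"
proof (rule fps_ext)
  fix n
  have "{a \<in> {0}. k * sq a = n} = (if n = 0 then {0} else {})" by auto
  then show "gf {0} (\<lambda>x. k * sq x) $ n = 1 $ n" by (simp add: gf_nth)
qed

lemma gf_UNIV_sq:
  assumes "0 < k"
  shows "gf UNIV (\<lambda>x. k * sq x) = 1 + 2 * gf {0<..} (\<lambda>x. k * sq x)"
proof -
  let ?w = "\<lambda>x. k * sq x"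
  have "UNIV = {0} \<union> (- {0::int})" by auto
  then have "gf UNIV ?w = gf ({0} \<union> - {0}) ?w" by (rule arg_cong)
  also have "\<dots> = gf {0} ?w + gf (- {0}) ?w"
    by (rule gf_Un) (auto intro: finite_fibres_sq[OF assms])
  also have "gf (- {0}) ?w = 2 * gf {x \<in> - {0}. 0 < x} ?w"
    by (rule gf_symmetric) (use assms in auto)
  also have "{x \<in> - {0}. 0 < x} = {0::int<..}" by auto
  also have "gf {0} ?w = 1" by (rule gf_zero)
  finally show ?thesis .
qed

lemma gf_even_sq:
  assumes "\<And>x. 2 * x \<in> A \<longleftrightarrow> x \<in> A"
  shows "gf {x \<in> A. even x} sq = gf A (\<lambda>x. 4 * sq x)"
proof (rule sym, rule gf_bij)
  show "bij_betw ((*) 2) A {x \<in> A. even x}"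
  proof (rule bij_betw_imageI)
    show "(*) 2 ` A = {x \<in> A. even x}"
    proof (intro equalityI subsetI)
      fix x assume x: "x \<in> {x \<in> A. even x}"
      then have "x = 2 * (x div 2)" by simp
      moreover from this have "x div 2 \<in> A" using x assms[of "x div 2"] by simp
      ultimately show "x \<in> (*) 2 ` A" by (rule image_eqI)
    qed (use assms in auto)
  qed (simp add: inj_on_def)
qed (simp add: sq_double)

abbreviation "theta_pos k \<equiv> gf {0::int<..} (\<lambda>x. k * sq x)"
abbreviation "theta_odd k \<equiv> gf {x::int. 0 < x \<and> odd x} (\<lambda>x. k * sq x)"

lemma theta_pos_split: "theta_pos 1 = theta_pos 4 + theta_odd 1"
proof -
  have "{0::int<..} = {x \<in> {0<..}. even x} \<union> {x. 0 < x \<and> odd x}" by auto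
  then have "gf {0<..} sq = gf ({x \<in> {0<..}. even x} \<union> {x. 0 < x \<and> odd x}) sq" by (rule arg_cong)
  also have "\<dots> = gf {x \<in> {0<..}. even x} sq + gf {x. 0 < x \<and> odd x} sq"
    by (rule gf_Un) (use finite_fibres_sq[of 1] in auto)
  also have "gf {x \<in> {0<..}. even x} sq = theta_pos 4" by (rule gf_even_sq) simp
  finally show ?thesis by simp
qed

text \<open>The map \<open>(x, y) \<mapsto> (x + y, x - y)\<close> doubles \<open>x\<^sup>2 + y\<^sup>2\<close> and has the pairs of equal parity as its image.
Counted over all integers this reads \<open>(1 + 2T)\<^sup>2 = (1 + 2V)\<^sup>2 + (2W)\<^sup>2\<close>, with \<open>T\<close>, \<open>V\<close> and \<open>W\<close> the
three series of the statement; divide by 4.\<close>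

lemma theta_rotation: "theta_pos 2 + theta_pos 2 ^ 2 = theta_pos 4 + theta_pos 4 ^ 2 + theta_odd 1 ^ 2"
proof -
  let ?w = "\<lambda>(u, v). sq u + sq v"
  let ?E = "{x::int. even x}" and ?O = "{x::int. odd x}"
  note fin = finite_fibres_sq[of 1, simplified]
  have "gf UNIV (\<lambda>x. 2 * sq x) ^ 2 = gf (UNIV \<times> UNIV) (\<lambda>(x, y). 2 * sq x + 2 * sq y)"
    unfolding power2_eq_square by (rule gf_Times[symmetric]) (simp_all add: finite_fibres_sq)
  also have "\<dots> = gf (?E \<times> ?E \<union> ?O \<times> ?O) ?w"
  proof (rule gf_bij)
    show "bij_betw (\<lambda>(x, y). (x + y, x - y)) (UNIV \<times> UNIV) (?E \<times> ?E \<union> ?O \<times> ?O)"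
    proof (rule bij_betwI[of _ _ _ "\<lambda>(u, v). ((u + v) div 2, (u - v) div 2)"])
      fix p :: "int \<times> int"
      assume p: "p \<in> ?E \<times> ?E \<union> ?O \<times> ?O"
      obtain u v where uv: "p = (u, v)" by (rule prod.exhaust)
      have "even (u + v)" using p uv by auto
      then have "(u + v) div 2 + (u - v) div 2 = u" "(u + v) div 2 - (u - v) div 2 = v" by presburger+
      then show "(\<lambda>(x, y). (x + y, x - y)) ((\<lambda>(u, v). ((u + v) div 2, (u - v) div 2)) p) = p"
        by (simp add: uv)
    qed auto
  next
    fix p :: "int \<times> int"
    obtain x y where p: "p = (x, y)" by (rule prod.exhaust)
    have "int (sq (x + y) + sq (x - y)) = int (2 * sq x + 2 * sq y)"
      by (simp add: of_nat_sq power2_eq_square algebra_simps)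
    then show "?w ((\<lambda>(x, y). (x + y, x - y)) p) = (\<lambda>(x, y). 2 * sq x + 2 * sq y) p"
      unfolding p by (simp only: of_nat_eq_iff prod.case)
  qed
  also have "\<dots> = gf (?E \<times> ?E) ?w + gf (?O \<times> ?O) ?w"
    by (rule gf_Un) (auto intro: finite_fibres_Times fin)
  also have "gf (?E \<times> ?E) ?w = gf ?E sq ^ 2" by (simp add: power2_eq_square gf_Times fin)
  also have "gf (?O \<times> ?O) ?w = gf ?O sq ^ 2" by (simp add: power2_eq_square gf_Times fin)
  also have "gf ?E sq = 1 + 2 * theta_pos 4"
    using gf_even_sq[of UNIV] gf_UNIV_sq[of 4] by simp
  also have "gf ?O sq = 2 * theta_odd 1"
    using gf_symmetric[of ?O 1] by (simp add: conj_commute)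
  also have "gf UNIV (\<lambda>x. 2 * sq x) = 1 + 2 * theta_pos 2" by (simp add: gf_UNIV_sq)
  finally have four: "4 * (theta_pos 2 + theta_pos 2 ^ 2) = 4 * (theta_pos 4 + theta_pos 4 ^ 2 + theta_odd 1 ^ 2)"
    by (simp add: power2_eq_square algebra_simps)
  have "(4::int fps) \<noteq> 0" by simp
  from mult_left_cancel[OF this, THEN iffD1, OF four] show ?thesis .
qed

text \<open>From \<open>\<psi> = B (1 + 2S)\<close> and the geometric series,
\<open>B = \<psi> (1 - 2S + 4S\<^sup>2 - 8S\<^sup>3 + 16S\<^sup>4 - 32S\<^sup>5) + 64 S\<^sup>6 B\<close>. Adding \<open>\<psi> (1 + 2S)\<^sup>3\<close> removes \<open>S\<^sup>3\<close> and leaves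
\<open>\<psi> (2 + 4S + 16S\<^sup>2 + 16S\<^sup>4 - 32S\<^sup>5)\<close>. Here \<open>S\<^sup>4\<close> is needed only modulo 4 and \<open>S\<^sup>5\<close> only modulo 2, where
squaring doubles the exponents, so they become \<open>T\<^sup>2\<close> and \<open>S V\<close>. The dissections of \<open>S\<close> and \<open>T\<close> then
turn \<open>S\<^sup>2 + T\<^sup>2 - 2 S V\<close> into \<open>2 W\<^sup>2 + V - T\<close>, and \<open>W\<^sup>2\<close> is needed only modulo 2.\<close>

lemma b4_series_mod_64:
  "\<exists>Z. b4_series + gf UNIV tri * gf UNIV sq ^ 3 =
     gf UNIV tri * (2 + 4 * theta_pos 1 + 32 * theta_odd 2 + 16 * theta_pos 4 - 16 * theta_pos 2) + 64 * Z"
proof -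
  define B \<Psi> S T V W W2 where "B = b4_series" and "\<Psi> = gf UNIV tri" and "S = theta_pos 1"
    and "T = theta_pos 2" and "V = theta_pos 4" and "W = theta_odd 1" and "W2 = theta_odd 2"
  note defs = this
  have P: "gf UNIV sq = 1 + 2 * S" using gf_UNIV_sq[of 1] by (simp add: defs)
  have \<Psi>: "\<Psi> = B * (1 + 2 * S)" using b4_series_theta P by (simp add: defs)
  obtain U1 where "S ^ 2 = T + 2 * U1"
    using gf_square[OF finite_fibres_sq[of 1 "{0<..}"]] by (auto simp: defs)
  obtain U2 where "T ^ 2 = V + 2 * U2"
    using gf_square[OF finite_fibres_sq[of 2 "{0<..}"]] by (auto simp: defs)
  obtain U3 where "W ^ 2 = W2 + 2 * U3"
    using gf_square[OF finite_fibres_sq[of 1 "{x. 0 < x \<and> odd x}"]] by (auto simp: defs)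
  have SVW: "S = V + W" using theta_pos_split by (simp add: defs)
  have rot: "T + T ^ 2 = V + V ^ 2 + W ^ 2" using theta_rotation by (simp add: defs)
  have S4: "S ^ 4 = T ^ 2 + 4 * (U1 * (T + U1))"
  proof -
    have "S ^ 4 = (S ^ 2) ^ 2" by simp
    then show ?thesis unfolding \<open>S ^ 2 = T + 2 * U1\<close> by (simp add: power2_eq_square algebra_simps)
  qed
  have S5: "S ^ 5 = S * V + 2 * (U2 * S) + 4 * (U1 * (T + U1) * S)"
  proof -
    have "S ^ 5 = S * S ^ 4" by (simp add: eval_nat_numeral)
    then show ?thesis unfolding S4 \<open>T ^ 2 = V + 2 * U2\<close> by (simp add: algebra_simps)
  qed
  have key: "S ^ 2 + T ^ 2 - 2 * (S * V) = 2 * (W2 + 2 * U3) + V - T"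
  proof -
    have "T ^ 2 = V + V ^ 2 + W ^ 2 - T" using rot by (simp add: algebra_simps)
    then have "S ^ 2 + T ^ 2 - 2 * (S * V) = 2 * W ^ 2 + V - T"
      unfolding SVW by (simp add: power2_eq_square algebra_simps)
    then show ?thesis by (simp only: \<open>W ^ 2 = W2 + 2 * U3\<close>)
  qed
  let ?Z' = "U1 * (T + U1) - U2 * S - 2 * (U1 * (T + U1) * S)"
  have "16 * S ^ 2 + 16 * S ^ 4 - 32 * S ^ 5 = 16 * (S ^ 2 + T ^ 2 - 2 * (S * V)) + 64 * ?Z'"
    unfolding S4 S5 by (simp add: algebra_simps)
  also have "\<dots> = 32 * W2 + 16 * V - 16 * T + 64 * (U3 + ?Z')"
    unfolding key by (simp add: algebra_simps)
  finally have red: "16 * S ^ 2 + 16 * S ^ 4 - 32 * S ^ 5 = 32 * W2 + 16 * V - 16 * T + 64 * (U3 + ?Z')" .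
  have "B + \<Psi> * (1 + 2 * S) ^ 3 = \<Psi> * (2 + 4 * S + (16 * S ^ 2 + 16 * S ^ 4 - 32 * S ^ 5)) + 64 * (S ^ 6 * B)"
    unfolding \<Psi> by (simp add: eval_nat_numeral algebra_simps)
  also have "\<dots> = \<Psi> * (2 + 4 * S + 32 * W2 + 16 * V - 16 * T) + 64 * (\<Psi> * (U3 + ?Z') + S ^ 6 * B)"
    unfolding red by (simp add: algebra_simps)
  finally show ?thesis unfolding P[symmetric] unfolding defs by blast
qed

section \<open>Coefficients of binary theta products\<close>

lemma seven_dvd_sum_two_squares:
  fixes a b :: int
  assumes "7 dvd a\<^sup>2 + b\<^sup>2"
  shows "7 dvd a \<and> 7 dvd b"
proof -
  define r s where "r = a mod 7" and "s = b mod 7"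
  have "[r * r + s * s = a * a + b * b] (mod 7)"
    unfolding r_def s_def by (intro cong_add cong_mult) (simp_all add: cong_def)
  then have "(r * r + s * s) mod 7 = (a * a + b * b) mod 7" by (simp only: cong_def)
  also have "\<dots> = 0" using assms by (simp only: dvd_eq_mod_eq_0 power2_eq_square)
  finally have 0: "(r * r + s * s) mod 7 = 0" .
  have *: "\<forall>r\<in>{0,1,2,3,4,5,6::int}. \<forall>s\<in>{0,1,2,3,4,5,6}. (r * r + s * s) mod 7 = 0 \<longrightarrow> r = 0 \<and> s = 0"
    by simp
  have r: "r \<in> {0,1,2,3,4,5,6}" and s: "s \<in> {0,1,2,3,4,5,6}"
    unfolding r_def s_def by (auto; presburger)+
  from *[THEN bspec, OF r, THEN bspec, OF s, THEN mp, OF 0] show ?thesis by (simp add: r_def s_def dvd_eq_mod_eq_0)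
qed

text \<open>Each of 1, 2, 4 is a square modulo 7, and so is 8; the form is therefore a sum of two squares modulo 7,
and \<open>- 1\<close> is not a square modulo 7.\<close>

lemma binary_form_avoids:
  fixes a x k M :: int
  assumes M: "a\<^sup>2 + 8 * (k * x\<^sup>2) = M" and k: "k \<in> {1, 2, 4}" and "7 dvd M"
  shows "49 dvd M"
proof -
  from k obtain t d where t: "k = t\<^sup>2 - 7 * d" "\<not> 7 dvd t"
  proof -
    have "1 = 1\<^sup>2 - 7 * (0::int)" "2 = 3\<^sup>2 - 7 * (1::int)" "4 = 2\<^sup>2 - 7 * (0::int)"
      "\<not> 7 dvd (1::int)" "\<not> 7 dvd (2::int)" "\<not> 7 dvd (3::int)" by simp_all
    then show ?thesis using k that by blast
  qed
  have "a\<^sup>2 + (t * x)\<^sup>2 = M - 7 * (k * x\<^sup>2 - d * x\<^sup>2)"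
    unfolding M[symmetric] t(1) by (simp add: algebra_simps power_mult_distrib)
  then have "7 dvd a\<^sup>2 + (t * x)\<^sup>2" using assms(3) by simp
  then have "7 dvd a" "7 dvd t * x" using seven_dvd_sum_two_squares by blast+
  then have "7 dvd a" "7 dvd x" using t(2) prime_dvd_mult_iff[of "7::int" t x] by auto
  then obtain b y where "a = 7 * b" "x = 7 * y" by (auto elim!: dvdE)
  then have "M = 49 * (b\<^sup>2 + 8 * (k * y\<^sup>2))"
    unfolding M[symmetric] by (simp add: power_mult_distrib algebra_simps)
  then show ?thesis by simp
qed

lemma tri_complete_square: "8 * int (tri j) + 1 = (4 * j + 1)\<^sup>2"
  unfolding of_nat_tri power2_eq_square by (simp only: algebra_simps)

lemma binary_coeff_0:
  assumes "7 dvd 8 * int N + 1" "\<not> 49 dvd 8 * int N + 1" "k \<in> {1, 2, 4}"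
  shows "(gf UNIV tri * gf A (\<lambda>x. k * sq x)) $ N = 0"
proof -
  have empty: "{p \<in> UNIV \<times> A. (\<lambda>(j, x). tri j + k * sq x) p = N} = {}"
  proof (rule ccontr)
    assume "{p \<in> UNIV \<times> A. (\<lambda>(j, x). tri j + k * sq x) p = N} \<noteq> {}"
    then obtain j x where "tri j + k * sq x = N" by auto
    then have "int N = int (tri j + k * sq x)" by simp
    also have "\<dots> = int (tri j) + int k * x\<^sup>2" by (simp add: of_nat_sq)
    finally have "int N = int (tri j) + int k * x\<^sup>2" .
    then have "(4 * j + 1)\<^sup>2 + 8 * (int k * x\<^sup>2) = 8 * int N + 1"
      unfolding tri_complete_square[symmetric] by simp
    then have "49 dvd 8 * int N + 1"
      by (rule binary_form_avoids) (use assms in auto)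
    then show False using assms(2) by simp
  qed
  have "0 < k" using assms(3) by auto
  then show ?thesis
    unfolding gf_Times[OF finite_fibres_tri finite_fibres_sq[OF \<open>0 < k\<close>], symmetric] gf_nth empty by simp
qed

section \<open>Representations by a quaternary form\<close>

text \<open>A free involution, in a form that is easy to iterate: \<open>P\<close> selects one element of every orbit.\<close>

lemma card_involution:
  assumes "finite A" "\<And>v. v \<in> A \<Longrightarrow> f v \<in> A" "\<And>v. v \<in> A \<Longrightarrow> f (f v) = v"
    and "\<And>v. v \<in> A \<Longrightarrow> P (f v) \<longleftrightarrow> \<not> P v"
  shows "card A = 2 * card {v \<in> A. P v}"
proof -
  have "bij_betw f {v \<in> A. P v} {v \<in> A. \<not> P v}"
    by (rule bij_betwI[of _ _ _ f]) (use assms in auto)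
  then have "card {v \<in> A. \<not> P v} = card {v \<in> A. P v}" by (simp add: bij_betw_same_card)
  moreover have "card ({v \<in> A. P v} \<union> {v \<in> A. \<not> P v}) = card {v \<in> A. P v} + card {v \<in> A. \<not> P v}"
    by (rule card_Un_disjoint) (use assms(1) in auto)
  moreover have "{v \<in> A. P v} \<union> {v \<in> A. \<not> P v} = A" by auto
  ultimately show ?thesis by simp
qed

definition reps_1_8_8_8 :: "int \<Rightarrow> (int \<times> int \<times> int \<times> int) set" where
  "reps_1_8_8_8 M = {(a, x, y, z). odd a \<and> a\<^sup>2 + 8 * (x\<^sup>2 + y\<^sup>2 + z\<^sup>2) = M}"

definition reps_1_2_4_4 :: "int \<Rightarrow> (int \<times> int \<times> int \<times> int) set" where
  "reps_1_2_4_4 m = {(p, w, r, s). odd p \<and> p\<^sup>2 + 2 * w\<^sup>2 + 4 * (r\<^sup>2 + s\<^sup>2) = m}"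

lemma finite_reps_1_8_8_8: "finite (reps_1_8_8_8 M)"
proof -
  have "reps_1_8_8_8 M \<subseteq> {-M..M} \<times> {-M..M} \<times> {-M..M} \<times> {-M..M}"
  proof
    fix v assume "v \<in> reps_1_8_8_8 M"
    then obtain a x y z where v: "v = (a, x, y, z)" "a\<^sup>2 + 8 * (x\<^sup>2 + y\<^sup>2 + z\<^sup>2) = M"
      by (auto simp: reps_1_8_8_8_def)
    have "a\<^sup>2 \<le> M \<and> x\<^sup>2 \<le> M \<and> y\<^sup>2 \<le> M \<and> z\<^sup>2 \<le> M"
      using zero_le_power2[of a] zero_le_power2[of x] zero_le_power2[of y] zero_le_power2[of z]
      unfolding v(2)[symmetric] by auto
    then have "\<bar>a\<bar> \<le> M" "\<bar>x\<bar> \<le> M" "\<bar>y\<bar> \<le> M" "\<bar>z\<bar> \<le> M"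
      using abs_le_square order_trans by blast+
    then show "v \<in> {-M..M} \<times> {-M..M} \<times> {-M..M} \<times> {-M..M}" using v by auto
  qed
  then show ?thesis by (rule finite_subset) simp
qed

lemma finite_reps_1_2_4_4: "finite (reps_1_2_4_4 m)"
proof -
  have "reps_1_2_4_4 m \<subseteq> {-m..m} \<times> {-m..m} \<times> {-m..m} \<times> {-m..m}"
  proof
    fix v assume "v \<in> reps_1_2_4_4 m"
    then obtain a x y z where v: "v = (a, x, y, z)" "a\<^sup>2 + 2 * x\<^sup>2 + 4 * (y\<^sup>2 + z\<^sup>2) = m"
      by (auto simp: reps_1_2_4_4_def)
    have "a\<^sup>2 \<le> m \<and> x\<^sup>2 \<le> m \<and> y\<^sup>2 \<le> m \<and> z\<^sup>2 \<le> m"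
      using zero_le_power2[of a] zero_le_power2[of x] zero_le_power2[of y] zero_le_power2[of z]
      unfolding v(2)[symmetric] by auto
    then have "\<bar>a\<bar> \<le> m" "\<bar>x\<bar> \<le> m" "\<bar>y\<bar> \<le> m" "\<bar>z\<bar> \<le> m"
      using abs_le_square order_trans by blast+
    then show "v \<in> {-m..m} \<times> {-m..m} \<times> {-m..m} \<times> {-m..m}" using v by auto
  qed
  then show ?thesis by (rule finite_subset) simp
qed

lemma square_odd_mod_8: "odd a \<Longrightarrow> a\<^sup>2 mod 8 = 1" for a :: int
proof -
  assume "odd a"
  then obtain k where a: "a = 2 * k + 1" by (rule oddE)
  have "even (k * (k + 1))" by simp
  then obtain l where l: "k * (k + 1) = 2 * l" by (rule evenE)
  have "a\<^sup>2 = 4 * (k * (k + 1)) + 1" unfolding a by (simp add: power2_eq_square algebra_simps)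
  then have "a\<^sup>2 = 8 * l + 1" unfolding l by simp
  then show ?thesis by simp
qed

text \<open>Odd squares are 1 modulo 8, so reducing the equation modulo 8 leaves
\<open>w\<^sup>2 + 2 (r\<^sup>2 + s\<^sup>2) = 3 (mod 4)\<close>.\<close>

lemma reps_1_2_4_4_parity:
  assumes "(p, w, r, s) \<in> reps_1_2_4_4 m" "m mod 8 = 7"
  shows "odd w" "odd (r + s)"
proof -
  have mod8: "odd b" "b mod 8 = 1 \<Longrightarrow> odd c"
    if "a mod 8 = 1" "(a + 2 * b + 4 * c) mod 8 = 7" for a b c :: int
    using that by presburger+
  have p: "p\<^sup>2 mod 8 = 1" and eq: "(p\<^sup>2 + 2 * w\<^sup>2 + 4 * (r\<^sup>2 + s\<^sup>2)) mod 8 = 7"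
    using assms square_odd_mod_8[of p] by (auto simp: reps_1_2_4_4_def)
  show w: "odd w" using mod8(1)[OF p eq] by simp
  show "odd (r + s)" using mod8(2)[OF p eq square_odd_mod_8[OF w]] by simp
qed

text \<open>Exactly one of \<open>r\<close> and \<open>s\<close> is odd; exchanging them if necessary, let it be \<open>r\<close>. Then \<open>p\<close>, \<open>w\<close>, \<open>r\<close> are all
odd, hence nonzero, and their signs can be changed independently.\<close>

lemma sixteen_dvd_card_reps_1_2_4_4:
  assumes "m mod 8 = 7"
  shows "16 dvd card (reps_1_2_4_4 m)"
proof -
  note par = reps_1_2_4_4_parity[OF _ assms]
  let ?A = "reps_1_2_4_4 m"
  let ?B = "{v \<in> ?A. case v of (p, w, r, s) \<Rightarrow> odd r}"
  let ?C = "{v \<in> ?B. case v of (p, w, r, s) \<Rightarrow> p > 0}"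
  let ?D = "{v \<in> ?C. case v of (p, w, r, s) \<Rightarrow> w > 0}"
  let ?E = "{v \<in> ?D. case v of (p, w, r, s) \<Rightarrow> r > 0}"
  have fin: "finite ?A" "finite ?B" "finite ?C" "finite ?D"
    using finite_reps_1_2_4_4 by simp_all
  have nz: "p \<noteq> 0" "w \<noteq> 0" if "(p, w, r, s) \<in> ?A" for p w r s
    using par[OF that] that by (auto simp: reps_1_2_4_4_def)
  have swap: "(p, w, s, r) \<in> ?A" and neg: "(-p, w, r, s) \<in> ?A" "(p, -w, r, s) \<in> ?A" "(p, w, -r, s) \<in> ?A"
    if "(p, w, r, s) \<in> ?A" for p w r s
    using that by (auto simp: reps_1_2_4_4_def add.commute)
  have flip: "- t > 0 \<longleftrightarrow> \<not> t > 0" if "t \<noteq> 0" for t :: int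
    using that by linarith
  have "card ?A = 2 * card ?B"
  proof (rule card_involution[where f = "\<lambda>(p, w, r, s). (p, w, s, r)"])
    fix v assume "v \<in> ?A"
    then show "(case (case v of (p, w, r, s) \<Rightarrow> (p, w, s, r)) of (p, w, r, s) \<Rightarrow> odd r) \<longleftrightarrow>
        \<not> (case v of (p, w, r, s) \<Rightarrow> odd r)"
      using par(2) by fastforce
  qed (use fin swap in auto)
  also have "card ?B = 2 * card ?C"
  proof (rule card_involution[where f = "\<lambda>(p, w, r, s). (-p, w, r, s)"])
    fix v assume "v \<in> ?B"
    moreover obtain p w r s where v: "v = (p, w, r, s)" by (rule prod_cases4)
    ultimately have "p \<noteq> 0" using nz[of p w r s] by auto
    with flip show "(case (case v of (p, w, r, s) \<Rightarrow> (-p, w, r, s)) of (p, w, r, s) \<Rightarrow> p > 0) \<longleftrightarrow>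
        \<not> (case v of (p, w, r, s) \<Rightarrow> p > 0)"
      by (simp add: v)
  qed (use fin neg in auto)
  also have "card ?C = 2 * card ?D"
  proof (rule card_involution[where f = "\<lambda>(p, w, r, s). (p, -w, r, s)"])
    fix v assume "v \<in> ?C"
    moreover obtain p w r s where v: "v = (p, w, r, s)" by (rule prod_cases4)
    ultimately have "w \<noteq> 0" using nz[of p w r s] by auto
    with flip show "(case (case v of (p, w, r, s) \<Rightarrow> (p, -w, r, s)) of (p, w, r, s) \<Rightarrow> w > 0) \<longleftrightarrow>
        \<not> (case v of (p, w, r, s) \<Rightarrow> w > 0)"
      by (simp add: v)
  qed (use fin neg in auto)
  also have "card ?D = 2 * card ?E"
  proof (rule card_involution[where f = "\<lambda>(p, w, r, s). (p, w, -r, s)"])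
    fix v assume "v \<in> ?D"
    moreover obtain p w r s where v: "v = (p, w, r, s)" by (rule prod_cases4)
    ultimately have "r \<noteq> 0" using nz[of p w r s] by auto
    with flip show "(case (case v of (p, w, r, s) \<Rightarrow> (p, w, -r, s)) of (p, w, r, s) \<Rightarrow> r > 0) \<longleftrightarrow>
        \<not> (case v of (p, w, r, s) \<Rightarrow> r > 0)"
      by (simp add: v)
  qed (use fin neg in auto)
  finally show ?thesis by simp
qed

text \<open>Modulo 7 this is the span of \<open>(1, 3, 3, 3)\<close> and \<open>(0, 1, 2, 4)\<close>, on which \<open>a\<^sup>2 + x\<^sup>2 + y\<^sup>2 + z\<^sup>2\<close>
vanishes identically.\<close>

definition plane_lattice :: "(int \<times> int \<times> int \<times> int) set" where
  "plane_lattice = {(a, x, y, z). 7 dvd y - 2 * x - 4 * a \<and> 7 dvd z - 4 * x - 5 * a}"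

text \<open>On the lattice the form \<open>a\<^sup>2 + 8 (x\<^sup>2 + y\<^sup>2 + z\<^sup>2)\<close> is 7 times a form isometric to \<open>p\<^sup>2 + 2w\<^sup>2 + 4r\<^sup>2 + 4s\<^sup>2\<close> on
the vectors with \<open>p = w = r + s (mod 2)\<close>, a condition that every solution in question satisfies. The
similitude \<open>h\<close> was found by matching short vectors; it satisfies
\<open>h\<^sup>T diag(1, 8, 8, 8) h = 7 diag(1, 2, 4, 4)\<close>, which determines the inverse \<open>f\<close>. Both maps contain
divisions, so each is evaluated in the integral coordinates of its lattice: \<open>(a, x, t, u)\<close>
for the plane and \<open>(p, i, r, k)\<close> for the other.\<close>

lemma card_reps_in_plane_lattice:
  assumes m: "m mod 8 = 7"
  shows "card (reps_1_8_8_8 (7 * m) \<inter> plane_lattice) = card (reps_1_2_4_4 m)"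
proof -
  define f where "f = (\<lambda>(a, x, y, z). ((a - 4*x - 4*y - 4*z) div 7, (- a - 4*x + 2*y) div 7,
     (- a + x - 2*y - z) div 7, (- x - 2*y + 3*z) div (7::int)))"
  define h where "h = (\<lambda>(p, w, r, s). (p - 2*w - 4*r, (- p - 2*w + r - s) div 2,
     (- p + w - 2*r - 2*s) div 2, (- p - r + 3*s) div (2::int)))"
  have d7: "7 * q div 7 = q" and d2: "2 * q div 2 = q" for q :: int by simp_all
  have f: "f (a, x, 2*x + 4*a + 7*t, 4*x + 5*a + 7*u) =
      (- 5*a - 4*x - 4*t - 4*u, a + 2*t, - 2*a - x - 2*t - u, a + x - 2*t + 3*u)" for a x t u
  proof -
    have "a - 4*x - 4*(2*x + 4*a + 7*t) - 4*(4*x + 5*a + 7*u) = 7 * (- 5*a - 4*x - 4*t - 4*u)"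
      "- a - 4*x + 2*(2*x + 4*a + 7*t) = 7 * (a + 2*t)"
      "- a + x - 2*(2*x + 4*a + 7*t) - (4*x + 5*a + 7*u) = 7 * (- 2*a - x - 2*t - u)"
      "- x - 2*(2*x + 4*a + 7*t) + 3*(4*x + 5*a + 7*u) = 7 * (a + x - 2*t + 3*u)"
      by algebra+
    then show ?thesis unfolding f_def by (simp only: prod.case d7)
  qed
  have h: "h (p, p + 2*i, r, p + r + 2*k) =
      (- p - 4*i - 4*r, - 2*p - 2*i - k, - p + i - 2*r - 2*k, p + r + 3*k)" for p i r k
  proof -
    have "- p - 2*(p + 2*i) + r - (p + r + 2*k) = 2 * (- 2*p - 2*i - k)"
      "- p + (p + 2*i) - 2*r - 2*(p + r + 2*k) = 2 * (- p + i - 2*r - 2*k)"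
      "- p - r + 3*(p + r + 2*k) = 2 * (p + r + 3*k)"
      by algebra+
    then show ?thesis unfolding h_def by (simp only: prod.case d2) simp
  qed
  have "bij_betw f (reps_1_8_8_8 (7 * m) \<inter> plane_lattice) (reps_1_2_4_4 m)"
  proof (rule bij_betwI[of _ _ _ h])
    have D: "\<exists>a x t u. v = (a, x, 2*x + 4*a + 7*t, 4*x + 5*a + 7*u)" if "v \<in> plane_lattice" for v
    proof -
      obtain a x y z where v: "v = (a, x, y, z)" by (metis prod_cases4)
      with that have "7 dvd y - 2 * x - 4 * a" "7 dvd z - 4 * x - 5 * a" by (auto simp: plane_lattice_def)
      then obtain t u where "y - 2 * x - 4 * a = 7 * t" "z - 4 * x - 5 * a = 7 * u" by (auto elim!: dvdE)
      then have "y = 2*x + 4*a + 7*t" "z = 4*x + 5*a + 7*u" by simp_all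
      with v show ?thesis by blast
    qed
    have T: "\<exists>p i r k. v = (p, p + 2*i, r, p + r + 2*k)" if v: "v \<in> reps_1_2_4_4 m" for v
    proof -
      obtain p w r s where v: "v = (p, w, r, s)" by (metis prod_cases4)
      with that have "odd p" "odd w" "odd (r + s)" using reps_1_2_4_4_parity[of p w r s m] m by (auto simp: reps_1_2_4_4_def)
      then have e: "even (w - p)" "even (s - p - r)" by auto
      obtain i where "w - p = 2 * i" using e(1) by (rule evenE)
      moreover obtain k where "s - p - r = 2 * k" using e(2) by (rule evenE)
      ultimately have "w = p + 2*i" "s = p + r + 2*k" by simp_all
      with v show ?thesis by blast
    qed
    show "f \<in> reps_1_8_8_8 (7 * m) \<inter> plane_lattice \<rightarrow> reps_1_2_4_4 m"
    proof
      fix v assume v: "v \<in> reps_1_8_8_8 (7 * m) \<inter> plane_lattice"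
      then obtain a x t u where vv: "v = (a, x, 2*x + 4*a + 7*t, 4*x + 5*a + 7*u)" using D by blast
      with v have eq: "a\<^sup>2 + 8 * (x\<^sup>2 + (2*x + 4*a + 7*t)\<^sup>2 + (4*x + 5*a + 7*u)\<^sup>2) = 7 * m" and "odd a"
        by (auto simp: reps_1_8_8_8_def)
      have "7 * ((- 5*a - 4*x - 4*t - 4*u)\<^sup>2 + 2 * (a + 2*t)\<^sup>2 + 4 * ((- 2*a - x - 2*t - u)\<^sup>2 + (a + x - 2*t + 3*u)\<^sup>2))
        = a\<^sup>2 + 8 * (x\<^sup>2 + (2*x + 4*a + 7*t)\<^sup>2 + (4*x + 5*a + 7*u)\<^sup>2)"
        by algebra
      then show "f v \<in> reps_1_2_4_4 m" using eq \<open>odd a\<close> unfolding vv f by (simp add: reps_1_2_4_4_def)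
    qed
    show "h \<in> reps_1_2_4_4 m \<rightarrow> reps_1_8_8_8 (7 * m) \<inter> plane_lattice"
    proof
      fix v assume v: "v \<in> reps_1_2_4_4 m"
      then obtain p i r k where vv: "v = (p, p + 2*i, r, p + r + 2*k)" using T by blast
      with v have eq: "p\<^sup>2 + 2 * (p + 2*i)\<^sup>2 + 4 * (r\<^sup>2 + (p + r + 2*k)\<^sup>2) = m" and "odd p"
        by (auto simp: reps_1_2_4_4_def)
      have "(- p - 4*i - 4*r)\<^sup>2 + 8 * ((- 2*p - 2*i - k)\<^sup>2 + (- p + i - 2*r - 2*k)\<^sup>2 + (p + r + 3*k)\<^sup>2)
         = 7 * (p\<^sup>2 + 2 * (p + 2*i)\<^sup>2 + 4 * (r\<^sup>2 + (p + r + 2*k)\<^sup>2))"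
        by algebra
      moreover have "(- p + i - 2*r - 2*k) - 2 * (- 2*p - 2*i - k) - 4 * (- p - 4*i - 4*r) = 7 * (p + 3*i + 2*r)"
        "(p + r + 3*k) - 4 * (- 2*p - 2*i - k) - 5 * (- p - 4*i - 4*r) = 7 * (2*p + 4*i + 3*r + k)"
        by algebra+
      ultimately show "h v \<in> reps_1_8_8_8 (7 * m) \<inter> plane_lattice"
        using eq \<open>odd p\<close> unfolding vv h by (auto simp: reps_1_8_8_8_def plane_lattice_def)
    qed
    show "h (f v) = v" if v: "v \<in> reps_1_8_8_8 (7 * m) \<inter> plane_lattice" for v
    proof -
      obtain a x t u where vv: "v = (a, x, 2*x + 4*a + 7*t, 4*x + 5*a + 7*u)" using D v by blast
      define p i r k where "p = - 5*a - 4*x - 4*t - 4*u" and "i = 3*a + 2*x + 3*t + 2*u"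
        and "r = - 2*a - x - 2*t - u" and "k = 4*a + 3*x + 2*t + 4*u"
      have "f v = (p, p + 2*i, r, p + r + 2*k)"
        unfolding vv f p_def i_def r_def k_def by simp
      then show ?thesis by (simp add: h) (simp add: vv p_def i_def r_def k_def)
    qed
    show "f (h v) = v" if v: "v \<in> reps_1_2_4_4 m" for v
    proof -
      obtain p i r k where vv: "v = (p, p + 2*i, r, p + r + 2*k)" using T v by blast
      define a x t u where "a = - p - 4*i - 4*r" and "x = - 2*p - 2*i - k"
        and "t = p + 3*i + 2*r" and "u = 2*p + 4*i + 3*r + k"
      have "h v = (a, x, 2*x + 4*a + 7*t, 4*x + 5*a + 7*u)"
        unfolding vv h a_def x_def t_def u_def by simp
      then show ?thesis by (simp add: f) (simp add: vv a_def x_def t_def u_def)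
    qed
  qed
  then show ?thesis by (rule bij_betw_same_card)
qed


definition signed_swaps :: "(int \<times> int \<times> bool) list" where
  "signed_swaps = [(1,1,False), (1,-1,False), (-1,1,False), (-1,-1,False), (1,1,True), (1,-1,True), (-1,1,True), (-1,-1,True)]"

text \<open>The signed permutations of the coordinates that fix \<open>a\<close>, preserve \<open>{x, y}\<close> up to sign and have
determinant 1 on \<open>(x, y, z)\<close>. They form a dihedral group of order 8, a Sylow 2-subgroup of the rotation group of the cube. Determinant 1
keeps each of the two families of isotropic planes stable.\<close>

fun signed_swap :: "int \<times> int \<times> bool \<Rightarrow> int \<times> int \<times> int \<times> int \<Rightarrow> int \<times> int \<times> int \<times> int" where
  "signed_swap (s, t, e) (a, x, y, z) = (if e then (a, s * y, t * x, - (s * t * z)) else (a, s * x, t * y, s * t * z))"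

text \<open>An executable form of membership in \<^const>\<open>plane_lattice\<close>, for the verification on residues.\<close>

definition in_plane_lattice :: "int \<times> int \<times> int \<times> int \<Rightarrow> bool" where
  "in_plane_lattice v = (case v of (a, x, y, z) \<Rightarrow> (y - 2 * x - 4 * a) mod 7 = 0 \<and> (z - 4 * x - 5 * a) mod 7 = 0)"

lemma in_plane_lattice_iff: "in_plane_lattice v \<longleftrightarrow> v \<in> plane_lattice"
  by (auto simp: in_plane_lattice_def plane_lattice_def dvd_eq_mod_eq_0 split: prod.splits)

definition residues7 :: "int list" where "residues7 = [0, 1, 2, 3, 4, 5, 6]"

text \<open>The eight images of the plane under the group are the eight planes of one family, so every nonzero
isotropic vector modulo 7 lies on exactly one of them. This is a check over all residues.\<close>

lemma isotropic_residues_in_one_plane: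
  "list_all (\<lambda>a. list_all (\<lambda>x. list_all (\<lambda>y. list_all (\<lambda>z.
     if (a * a + x * x + y * y + z * z) mod 7 = 0 \<and> (a, x, y, z) \<noteq> (0, 0, 0, 0)
     then length (filter (\<lambda>g. in_plane_lattice (signed_swap g (a, x, y, z))) signed_swaps) = 1
     else True) residues7) residues7) residues7) residues7"
  by code_simp

lemma distinct_signed_swaps: "distinct signed_swaps"
  by (simp add: signed_swaps_def)

lemma in_plane_lattice_signed_swap_mod:
  assumes "g \<in> set signed_swaps"
  shows "in_plane_lattice (signed_swap g (a mod 7, x mod 7, y mod 7, z mod 7)) \<longleftrightarrow> in_plane_lattice (signed_swap g (a, x, y, z))"
proof -
  have lin: "(p * (a mod 7) + q * (x mod 7) + r * (y mod 7) + u * (z mod 7)) mod 7 = (p * a + q * x + r * y + u * z) mod 7"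
    for p q r u :: int
    unfolding cong_def[symmetric] by (intro cong_add cong_mult cong_refl) (simp_all add: cong_def)
  obtain s t e where g: "g = (s, t, e)" by (rule prod_cases3)
  show ?thesis
  proof (cases e)
    case True
    then show ?thesis
      using lin[of "-4" t "- (2 * s)" 0] lin[of "-5" 0 "- (4 * s)" "- (s * t)"]
      by (simp add: g in_plane_lattice_def algebra_simps)
  next
    case False
    then show ?thesis
      using lin[of "-4" "- (2 * s)" t 0] lin[of "-5" "- (4 * s)" 0 "s * t"]
      by (simp add: g in_plane_lattice_def algebra_simps)
  qed
qed

lemma isotropic_vector_in_one_plane:
  assumes "7 dvd a\<^sup>2 + x\<^sup>2 + y\<^sup>2 + z\<^sup>2" "\<not> (7 dvd a \<and> 7 dvd x \<and> 7 dvd y \<and> 7 dvd z)"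
  shows "\<exists>!g. g \<in> set signed_swaps \<and> signed_swap g (a, x, y, z) \<in> plane_lattice"
proof -
  have res: "b mod 7 \<in> set residues7" for b :: int
  proof -
    have "b mod 7 \<in> {0..<7}" by simp
    also have "{0..<7} = set residues7" unfolding residues7_def by (auto; presburger)
    finally show ?thesis .
  qed
  let ?a = "a mod 7" and ?x = "x mod 7" and ?y = "y mod 7" and ?z = "z mod 7"
  have "(?a * ?a + ?x * ?x + ?y * ?y + ?z * ?z) mod 7 = (a * a + x * x + y * y + z * z) mod 7"
    unfolding cong_def[symmetric] by (intro cong_add cong_mult) (simp_all add: cong_def)
  also have "\<dots> = 0"
    using assms(1) by (simp only: dvd_eq_mod_eq_0 power2_eq_square)
  finally have "(?a * ?a + ?x * ?x + ?y * ?y + ?z * ?z) mod 7 = 0" .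
  moreover have "(?a, ?x, ?y, ?z) \<noteq> (0, 0, 0, 0)"
    using assms(2) by (auto simp: dvd_eq_mod_eq_0)
  moreover note isotropic_residues_in_one_plane[unfolded list_all_iff, THEN bspec, OF res[of a], THEN bspec, OF res[of x],
    THEN bspec, OF res[of y], THEN bspec, OF res[of z]]
  ultimately have "length (filter (\<lambda>g. in_plane_lattice (signed_swap g (?a, ?x, ?y, ?z))) signed_swaps) = 1"
    by (simp only: if_True simp_thms)
  also have "filter (\<lambda>g. in_plane_lattice (signed_swap g (?a, ?x, ?y, ?z))) signed_swaps = filter (\<lambda>g. signed_swap g (a, x, y, z) \<in> plane_lattice) signed_swaps"
    by (rule filter_cong) (simp_all only: in_plane_lattice_signed_swap_mod in_plane_lattice_iff[symmetric])
  finally obtain g where g: "filter (\<lambda>g. signed_swap g (a, x, y, z) \<in> plane_lattice) signed_swaps = [g]"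
    by (auto simp: length_Suc_conv)
  have "(h \<in> set signed_swaps \<and> signed_swap h (a, x, y, z) \<in> plane_lattice) = (h = g)" for h
    using arg_cong[OF g, of "\<lambda>l. h \<in> set l"]
    by (simp only: set_filter mem_Collect_eq list.set insert_iff empty_iff simp_thms)
  then show ?thesis by (simp only:) blast
qed

text \<open>As \<open>8 = 1 (mod 7)\<close>, a solution is an isotropic vector modulo 7; it is not zero modulo 7, since 49 does
not divide \<open>7 m\<close>. So the solutions split into eight classes according to the plane they lie on, and the
group carries each class onto the one of the chosen plane.\<close>

lemma card_reps_eq_8_times_plane:
  assumes "\<not> 7 dvd m"
  shows "card (reps_1_8_8_8 (7 * m)) = 8 * card (reps_1_8_8_8 (7 * m) \<inter> plane_lattice)"
proof -
  let ?R = "reps_1_8_8_8 (7 * m)"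
  let ?S = "\<lambda>g. {v \<in> ?R. signed_swap g v \<in> plane_lattice}"
  have uniq: "\<exists>!g. g \<in> set signed_swaps \<and> signed_swap g v \<in> plane_lattice" if v: "v \<in> ?R" for v
  proof -
    obtain a x y z where vv: "v = (a, x, y, z)" by (rule prod_cases4)
    with v have eq: "a\<^sup>2 + 8 * (x\<^sup>2 + y\<^sup>2 + z\<^sup>2) = 7 * m" by (simp add: reps_1_8_8_8_def)
    then have "a\<^sup>2 + x\<^sup>2 + y\<^sup>2 + z\<^sup>2 = 7 * (m - (x\<^sup>2 + y\<^sup>2 + z\<^sup>2))" by simp
    then have "7 dvd a\<^sup>2 + x\<^sup>2 + y\<^sup>2 + z\<^sup>2" by (metis dvd_triv_left)
    moreover have "\<not> (7 dvd a \<and> 7 dvd x \<and> 7 dvd y \<and> 7 dvd z)"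
    proof
      assume "7 dvd a \<and> 7 dvd x \<and> 7 dvd y \<and> 7 dvd z"
      then obtain a' x' y' z' where "a = 7 * a'" "x = 7 * x'" "y = 7 * y'" "z = 7 * z'"
        by (meson dvdE)
      then have "7 * (7 * (a'\<^sup>2 + 8 * (x'\<^sup>2 + y'\<^sup>2 + z'\<^sup>2))) = 7 * m"
        using eq by (simp add: power_mult_distrib)
      then have "m = 7 * (a'\<^sup>2 + 8 * (x'\<^sup>2 + y'\<^sup>2 + z'\<^sup>2))" by simp
      then show False using assms by simp
    qed
    ultimately show ?thesis unfolding vv by (rule isotropic_vector_in_one_plane)
  qed
  have card: "card (?S g) = card (?R \<inter> plane_lattice)" if g: "g \<in> set signed_swaps" for g
  proof -
    obtain s t e where g': "g = (s, t, e)" by (rule prod_cases3)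
    let ?h = "if e then (t, s, e) else (s, t, e)"
    have s: "s = 1 \<or> s = -1" and t: "t = 1 \<or> t = -1" using g g' by (auto simp: signed_swaps_def)
    have inv: "signed_swap ?h (signed_swap g v) = v" "signed_swap g (signed_swap ?h v) = v" for v
      using s t unfolding g' by (cases v; cases e; elim disjE; simp)+
    have R: "signed_swap g v \<in> ?R \<longleftrightarrow> v \<in> ?R" "signed_swap ?h v \<in> ?R \<longleftrightarrow> v \<in> ?R" for v
      using s t unfolding g' reps_1_8_8_8_def by (cases v; cases e; elim disjE; simp add: ac_simps)+
    have "bij_betw (signed_swap g) (?S g) (?R \<inter> plane_lattice)"
      by (rule bij_betwI[of _ _ _ "signed_swap ?h"]) (use inv R in auto)
    then show ?thesis by (rule bij_betw_same_card)
  qed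
  have "?R = (\<Union>g\<in>set signed_swaps. ?S g)" using uniq by blast
  then have "card ?R = card (\<Union>g\<in>set signed_swaps. ?S g)" by simp
  also have "\<dots> = (\<Sum>g\<in>set signed_swaps. card (?S g))"
  proof (rule card_UN_disjoint)
    show "\<forall>g\<in>set signed_swaps. finite (?S g)" using finite_reps_1_8_8_8 by simp
    show "\<forall>g\<in>set signed_swaps. \<forall>h\<in>set signed_swaps. g \<noteq> h \<longrightarrow> ?S g \<inter> ?S h = {}" using uniq by blast
  qed simp
  also have "\<dots> = card (set signed_swaps) * card (?R \<inter> plane_lattice)" using card by simp
  also have "card (set signed_swaps) = 8" using distinct_card[OF distinct_signed_swaps] by (simp add: signed_swaps_def)
  finally show ?thesis .
qed

theorem card_reps_dvd_128:
  assumes "m mod 8 = 7" "\<not> 7 dvd m"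
  shows "128 dvd card (reps_1_8_8_8 (7 * m))"
proof -
  obtain k where "card (reps_1_2_4_4 m) = 16 * k" using sixteen_dvd_card_reps_1_2_4_4[OF assms(1)] by (rule dvdE)
  then have "card (reps_1_8_8_8 (7 * m)) = 128 * k"
    using card_reps_eq_8_times_plane[OF assms(2)] card_reps_in_plane_lattice[OF assms(1)] by simp
  then show ?thesis by simp
qed

section \<open>The congruence\<close>

text \<open>The substitution \<open>a = 4j + 1\<close> gives the solutions with \<open>a = 1 (mod 4)\<close>, which are half of the solutions
with \<open>a\<close> odd.\<close>

lemma quaternary_coeff:
  assumes N: "8 * int N + 1 = 7 * m" and m: "m mod 8 = 7" "\<not> 7 dvd m"
  shows "64 dvd (gf UNIV tri * gf UNIV sq ^ 3) $ N"
proof -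
  let ?w = "\<lambda>(j, x, y, z). tri j + (sq x + (sq y + sq z))"
  let ?P = "\<lambda>(a, x, y, z). a mod 4 = (1::int)"
  let ?A = "{v \<in> reps_1_8_8_8 (7 * m). ?P v}"
  note fin = finite_fibres_sq[of 1, simplified]
  have "gf UNIV tri * gf UNIV sq ^ 3 = gf UNIV tri * (gf UNIV sq * (gf UNIV sq * gf UNIV sq))"
    by (simp add: power3_eq_cube mult.assoc)
  also have "\<dots> = gf (UNIV \<times> UNIV \<times> UNIV \<times> UNIV) ?w"
  proof -
    have 1: "gf UNIV sq * gf UNIV sq = gf (UNIV \<times> UNIV) (\<lambda>(y, z). sq y + sq z)"
      by (rule gf_Times[symmetric]) (rule fin)+
    have f1: "finite_fibres (UNIV \<times> UNIV) (\<lambda>(y, z). sq y + sq z)"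
      by (rule finite_fibres_Times) (rule fin)+
    have 2: "gf UNIV sq * gf (UNIV \<times> UNIV) (\<lambda>(y, z). sq y + sq z) =
        gf (UNIV \<times> UNIV \<times> UNIV) (\<lambda>(x, p). sq x + (case p of (y, z) \<Rightarrow> sq y + sq z))"
      by (rule gf_Times[symmetric]) (rule fin f1)+
    have f2: "finite_fibres (UNIV \<times> UNIV \<times> UNIV) (\<lambda>(x, p). sq x + (case p of (y, z) \<Rightarrow> sq y + sq z))"
      by (rule finite_fibres_Times) (rule fin f1)+
    have "gf UNIV tri * gf (UNIV \<times> UNIV \<times> UNIV) (\<lambda>(x, p). sq x + (case p of (y, z) \<Rightarrow> sq y + sq z)) =
        gf (UNIV \<times> UNIV \<times> UNIV \<times> UNIV)
          (\<lambda>(j, q). tri j + (case q of (x, p) \<Rightarrow> sq x + (case p of (y, z) \<Rightarrow> sq y + sq z)))"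
      by (rule gf_Times[symmetric]) (rule finite_fibres_tri f2)+
    also have "(\<lambda>(j, q). tri j + (case q of (x, p) \<Rightarrow> sq x + (case p of (y, z) \<Rightarrow> sq y + sq z))) = ?w"
      by (simp add: fun_eq_iff split: prod.split)
    finally show ?thesis unfolding 1 2 .
  qed
  finally have "(gf UNIV tri * gf UNIV sq ^ 3) $ N = int (card {v. ?w v = N})"
    by (simp add: gf_nth)
  also have "card {v. ?w v = N} = card ?A"
  proof (rule bij_betw_same_card)
    have eq: "tri j + (sq x + (sq y + sq z)) = N \<longleftrightarrow> (4 * j + 1)\<^sup>2 + 8 * (x\<^sup>2 + y\<^sup>2 + z\<^sup>2) = 7 * m" for j x y z
    proof -
      have "tri j + (sq x + (sq y + sq z)) = N \<longleftrightarrow> int (tri j) + (x\<^sup>2 + y\<^sup>2 + z\<^sup>2) = int N"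
        by (simp add: of_nat_sq add.assoc flip: of_nat_eq_iff[where 'a = int])
      also have "\<dots> \<longleftrightarrow> (8 * int (tri j) + 1) + 8 * (x\<^sup>2 + y\<^sup>2 + z\<^sup>2) = 8 * int N + 1" by auto
      finally show ?thesis unfolding tri_complete_square N .
    qed
    show "bij_betw (\<lambda>(j, x, y, z). (4 * j + 1, x, y, z)) {v. ?w v = N} ?A"
    proof (rule bij_betwI[of _ _ _ "\<lambda>(a, x, y, z). (a div 4, x, y, z)"])
      show "(\<lambda>(j, x, y, z). (4 * j + 1, x, y, z)) \<in> {v. ?w v = N} \<rightarrow> ?A"
        using eq by (auto simp: reps_1_8_8_8_def)
      show "(\<lambda>(a, x, y, z). (a div 4, x, y, z)) \<in> ?A \<rightarrow> {v. ?w v = N}"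
      proof
        fix v assume v: "v \<in> ?A"
        obtain a x y z where vv: "v = (a, x, y, z)" by (rule prod_cases4)
        have "a mod 4 = 1" using v vv by simp
        then have "a = 4 * (a div 4) + 1" by presburger
        then show "(\<lambda>(a, x, y, z). (a div 4, x, y, z)) v \<in> {v. ?w v = N}"
          using v eq[of "a div 4" x y z] by (auto simp: vv reps_1_8_8_8_def)
      qed
      show "(\<lambda>(j, x, y, z). (4 * j + 1, x, y, z)) ((\<lambda>(a, x, y, z). (a div 4, x, y, z)) v) = v"
        if "v \<in> ?A" for v
      proof -
        have "4 * (a div 4) + 1 = a" if "a mod 4 = 1" for a :: int using that by presburger
        then show ?thesis using that by auto
      qed
    qed auto
  qed
  finally have c: "(gf UNIV tri * gf UNIV sq ^ 3) $ N = int (card ?A)" .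
  have "card (reps_1_8_8_8 (7 * m)) = 2 * card ?A"
  proof (rule card_involution[where f = "\<lambda>(a, x, y, z). (- a, x, y, z)"])
    fix v assume v: "v \<in> reps_1_8_8_8 (7 * m)"
    obtain a x y z where vv: "v = (a, x, y, z)" by (rule prod_cases4)
    have "odd a" using v vv by (simp add: reps_1_8_8_8_def)
    then have "(- a) mod 4 = 1 \<longleftrightarrow> \<not> a mod 4 = 1" by presburger
    then show "?P ((\<lambda>(a, x, y, z). (- a, x, y, z)) v) \<longleftrightarrow> \<not> ?P v" by (simp add: vv)
  qed (use finite_reps_1_8_8_8 in \<open>auto simp: reps_1_8_8_8_def\<close>)
  with card_reps_dvd_128[OF m] have "64 dvd card ?A" by presburger
  then have "int 64 dvd int (card ?A)" by (simp only: of_nat_dvd_iff)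
  then show ?thesis unfolding c by simp
qed

theorem theorem5p4:
  fixes \<alpha> n :: nat
  assumes "\<alpha> \<in> {13, 20, 27, 34, 41, 48}"
  shows "[b4 (49 * n + \<alpha>) = 0] (mod 64)"
proof -
  define N where "N = 49 * n + \<alpha>"
  from assms obtain c :: int where c: "8 * int \<alpha> + 1 = 7 * c" "c mod 8 = 7" "\<not> 7 dvd c"
  proof -
    have "\<exists>c::int. 8 * int \<alpha> + 1 = 7 * c \<and> c mod 8 = 7 \<and> \<not> 7 dvd c"
      using assms by (auto intro: exI[of _ 15] exI[of _ 23] exI[of _ 31] exI[of _ 39] exI[of _ 47] exI[of _ 55])
    then show ?thesis using that by blast
  qed
  \<comment> \<open>Here \<open>c\<close> runs through 15, 23, 31, 39, 47, 55, the numbers below 56 that are 7 modulo 8, except 7 itself.\<close>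
  define m where "m = 56 * int n + c"
  have N: "8 * int N + 1 = 7 * m" using c(1) by (simp add: N_def m_def)
  have m: "m mod 8 = 7" "\<not> 7 dvd m"
  proof -
    show "m mod 8 = 7" unfolding m_def using c(2) by presburger
    show "\<not> 7 dvd m" unfolding m_def using c(3) by presburger
  qed
  have 7: "7 dvd 8 * int N + 1" unfolding N by simp
  have 49: "\<not> 49 dvd 8 * int N + 1" using m(2) unfolding N by presburger
  note b0 = binary_coeff_0[OF 7 49]
  obtain Z where Z: "b4_series + gf UNIV tri * gf UNIV sq ^ 3 =
     gf UNIV tri * (2 + 4 * theta_pos 1 + 32 * theta_odd 2 + 16 * theta_pos 4 - 16 * theta_pos 2) + 64 * Z"
    using b4_series_mod_64 by blast
  have "b4_series $ N + (gf UNIV tri * gf UNIV sq ^ 3) $ N = 64 * Z $ N"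
  proof -
    define \<Psi> where "\<Psi> = gf UNIV tri"
    have "\<Psi> * (2 + 4 * theta_pos 1 + 32 * theta_odd 2 + 16 * theta_pos 4 - 16 * theta_pos 2) =
      fps_const 2 * \<Psi> + fps_const 4 * (\<Psi> * theta_pos 1) + fps_const 32 * (\<Psi> * theta_odd 2) +
      fps_const 16 * (\<Psi> * theta_pos 4) - fps_const 16 * (\<Psi> * theta_pos 2)"
      by (simp add: algebra_simps numeral_fps_const)
    moreover have "64 * Z = fps_const 64 * Z" by (simp add: numeral_fps_const)
    ultimately have "(b4_series + gf UNIV tri * gf UNIV sq ^ 3) $ N =
      (fps_const 2 * \<Psi> + fps_const 4 * (\<Psi> * theta_pos 1) + fps_const 32 * (\<Psi> * theta_odd 2) +
      fps_const 16 * (\<Psi> * theta_pos 4) - fps_const 16 * (\<Psi> * theta_pos 2) + fps_const 64 * Z) $ N"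
      unfolding \<Psi>_def[symmetric] unfolding Z[folded \<Psi>_def] by (simp only:)
    moreover have "\<Psi> $ N = 0"
      using b0[of 1 "{0}"] by (simp add: \<Psi>_def gf_zero[of 1, simplified])
    moreover have "(\<Psi> * theta_pos 1) $ N = 0" "(\<Psi> * theta_odd 2) $ N = 0"
      "(\<Psi> * theta_pos 4) $ N = 0" "(\<Psi> * theta_pos 2) $ N = 0"
      unfolding \<Psi>_def by (rule b0; simp)+
    ultimately show ?thesis
      by (simp add: fps_add_nth fps_sub_nth)
  qed
  then have "b4_series $ N = 64 * Z $ N - (gf UNIV tri * gf UNIV sq ^ 3) $ N" by simp
  then have "64 dvd b4_series $ N" using quaternary_coeff[OF N m] by simp
  then have "int 64 dvd int (b4 N)" by (simp add: b4_series_def minus_one_power_iff split: if_splits)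
  then have "64 dvd b4 N" by (simp only: of_nat_dvd_iff)
  then show ?thesis by (simp add: N_def cong_0_iff)
qed

end
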